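(* Consider a market over $N$ ordered outcomes $\{0,1,\dots,N-1\}$ with share vector $\mathbf{q}=(q_0,\dots,q_{N-1})$, initially zero, in which traders purchase interval securities. There is a data structure that processes an online sequence of interval purchases and supports queries of the maximum quantity $q_{\max}=\max_iq_i$ and of the number $s_{q\max}=|\{i:q_i=q_{\max}\}|$ of outcomes attaining it, such that, if $k$ denotes the number of unique interval endpoints among the purchases made so far, the data structure uses $O(k)$ space, each interval purchase is processed in $O(\log k)$ time, and each query of $q_{\max}$ and $s_{q\max}$ takes $O(1)$ time. In particular, these bounds do not depend on $N$.
   Context: An interval security corresponds to a nonempty set of consecutive outcomes $[l,r]=\{l,l+1,\dots,r\}\subseteq\{0,\dots,N-1\}$; purchasing quantity $v>0$ of it replaces $q_i$ by $q_i+v$ for $l\le i\le r$ and leaves the other entries unchanged. The endpoints contributed by the purchase of $[l,r]$ are $l$ and $r+1$, so that $k\le 2U$ where $U$ is the number of distinct interval purchases. Running times are in a model where arithmetic operations and comparisons on indices and quantities take constant time. *)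

theory Defs
  imports Complex_Main
begin

section \<open>Interval purchases in a market over ordered outcomes\<close>

datatype request =
    Purchase nat nat real  \<comment> \<open>\<open>Purchase l r v\<close>: quantity \<open>v\<close> of the security on \<open>{l..r}\<close>\<close>
  | Query_Max
  | Query_Count

fun valid_request :: "nat \<Rightarrow> request \<Rightarrow> bool" where
  "valid_request N (Purchase l r v) \<longleftrightarrow> l \<le> r \<and> r < N \<and> 0 < v"
| "valid_request N Query_Max \<longleftrightarrow> True"
| "valid_request N Query_Count \<longleftrightarrow> True"

fun update_shares :: "request \<Rightarrow> (nat \<Rightarrow> real) \<Rightarrow> (nat \<Rightarrow> real)" where
  "update_shares (Purchase l r v) q = (\<lambda>i. if i \<in> {l..r} then q i + v else q i)"
| "update_shares Query_Max q = q"
| "update_shares Query_Count q = q"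

text \<open>Only the entries with index below the number \<open>N\<close> of outcomes are meaningful.\<close>

definition shares :: "request list \<Rightarrow> nat \<Rightarrow> real" where
  "shares rs = fold update_shares rs (\<lambda>i. 0)"

definition q_max :: "nat \<Rightarrow> (nat \<Rightarrow> real) \<Rightarrow> real" where
  "q_max N q = Max (q ` {..<N})"

definition s_qmax :: "nat \<Rightarrow> (nat \<Rightarrow> real) \<Rightarrow> nat" where
  "s_qmax N q = card {i \<in> {..<N}. q i = q_max N q}"

fun request_endpoints :: "request \<Rightarrow> nat set" where
  "request_endpoints (Purchase l r v) = {l, r + 1}"
| "request_endpoints Query_Max = {}"
| "request_endpoints Query_Count = {}"

definition num_endpoints :: "request list \<Rightarrow> nat" where
  "num_endpoints rs = card (\<Union>r \<in> set rs. request_endpoints r)"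


section \<open>The machine model\<close>

text \<open>
  A random access machine with recursive procedures. A word holds either a natural number
  (outcome index, count or memory address) or a real quantity, and there is no conversion between
  the two. The only primitive operations are addition, subtraction (truncated on naturals) and
  comparisons. Multiplication, division and rounding are left out on purpose: at unit cost on
  unbounded numbers they would allow arbitrarily much data to be packed into one word. For the
  same reason 0 is the only quantity constant.
\<close>

datatype val = Idx nat | Qty real

datatype binop = Add | Sub | Less | Equal

fun apply_binop :: "binop \<Rightarrow> val \<Rightarrow> val \<Rightarrow> val option" where
  "apply_binop Add (Idx a) (Idx b) = Some (Idx (a + b))"
| "apply_binop Sub (Idx a) (Idx b) = Some (Idx (a - b))"
| "apply_binop Less (Idx a) (Idx b) = Some (Idx (of_bool (a < b)))"
| "apply_binop Equal (Idx a) (Idx b) = Some (Idx (of_bool (a = b)))"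
| "apply_binop Add (Qty x) (Qty y) = Some (Qty (x + y))"
| "apply_binop Sub (Qty x) (Qty y) = Some (Qty (x - y))"
| "apply_binop Less (Qty x) (Qty y) = Some (Idx (of_bool (x < y)))"
| "apply_binop Equal (Qty x) (Qty y) = Some (Idx (of_bool (x = y)))"
| "apply_binop _ _ _ = None"

datatype expr =
    Const_Idx nat
  | Zero_Qty
  | Var nat
  | Binop binop expr expr
  | Cond expr expr expr
  | Bind nat expr expr      \<comment> \<open>\<open>Bind x e b\<close>: let local variable \<open>x\<close> be \<open>e\<close> in \<open>b\<close>\<close>
  | Read expr
  | Write expr expr         \<comment> \<open>\<open>Write a e\<close>: store \<open>e\<close> at address \<open>a\<close>; the value is that of \<open>e\<close>\<close>
  | Call nat "expr list"    \<comment> \<open>\<open>Call f es\<close>: invoke the \<open>f\<close>-th procedure\<close>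

type_synonym env = "nat \<Rightarrow> val option"

text \<open>
  The memory consists of the words at addresses \<open>0, \<dots>, length M - 1\<close>. It never shrinks, and
  it grows only by a write to the first unused address. Hence \<open>length M\<close> is the peak memory use
  up to the present.
\<close>

type_synonym mem = "val list"

text \<open>A procedure is given by its body, in which the parameters are the variables \<open>0, 1, \<dots>\<close>.\<close>

type_synonym procs = "expr list"

definition args :: "val list \<Rightarrow> env" where
  "args vs = (\<lambda>i. if i < length vs then Some (vs ! i) else None)"

text \<open>
  \<open>exec P \<rho> M e v M' t\<close>: with procedures \<open>P\<close> and local variables \<open>\<rho>\<close>, evaluating \<open>e\<close> in memory
  \<open>M\<close> terminates after \<open>t\<close> steps with value \<open>v\<close> and memory \<open>M'\<close>. Every constructor that is
  evaluated costs one step. Ill-sorted operations, unbound variables, accesses outside the memory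
  and non-termination have no derivation. The call stack is not part of the memory; its depth is at
  most \<open>t\<close>, and it is empty between requests.
\<close>

inductive exec :: "procs \<Rightarrow> env \<Rightarrow> mem \<Rightarrow> expr \<Rightarrow> val \<Rightarrow> mem \<Rightarrow> nat \<Rightarrow> bool"
  and execs :: "procs \<Rightarrow> env \<Rightarrow> mem \<Rightarrow> expr list \<Rightarrow> val list \<Rightarrow> mem \<Rightarrow> nat \<Rightarrow> bool"
  for P :: procs
where
  exec_Const: "exec P \<rho> M (Const_Idx n) (Idx n) M 1"
| exec_Zero: "exec P \<rho> M Zero_Qty (Qty 0) M 1"
| exec_Var: "\<rho> x = Some v \<Longrightarrow> exec P \<rho> M (Var x) v M 1"
| exec_Binop: "\<lbrakk>exec P \<rho> M e1 v1 M1 t1; exec P \<rho> M1 e2 v2 M2 t2; apply_binop f v1 v2 = Some v\<rbrakk>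
    \<Longrightarrow> exec P \<rho> M (Binop f e1 e2) v M2 (1 + t1 + t2)"
| exec_Cond: "\<lbrakk>exec P \<rho> M b (Idx n) M1 t1; exec P \<rho> M1 (if n = 0 then e2 else e1) v M2 t2\<rbrakk>
    \<Longrightarrow> exec P \<rho> M (Cond b e1 e2) v M2 (1 + t1 + t2)"
| exec_Bind: "\<lbrakk>exec P \<rho> M e v1 M1 t1; exec P (\<rho>(x := Some v1)) M1 b v M2 t2\<rbrakk>
    \<Longrightarrow> exec P \<rho> M (Bind x e b) v M2 (1 + t1 + t2)"
| exec_Read: "\<lbrakk>exec P \<rho> M e (Idx a) M1 t1; a < length M1\<rbrakk>
    \<Longrightarrow> exec P \<rho> M (Read e) (M1 ! a) M1 (1 + t1)"
| exec_Write: "\<lbrakk>exec P \<rho> M e1 (Idx a) M1 t1; exec P \<rho> M1 e2 v M2 t2; a < length M2\<rbrakk>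
    \<Longrightarrow> exec P \<rho> M (Write e1 e2) v (M2[a := v]) (1 + t1 + t2)"
| exec_Extend: "\<lbrakk>exec P \<rho> M e1 (Idx a) M1 t1; exec P \<rho> M1 e2 v M2 t2; a = length M2\<rbrakk>
    \<Longrightarrow> exec P \<rho> M (Write e1 e2) v (M2 @ [v]) (1 + t1 + t2)"
| exec_Call: "\<lbrakk>execs P \<rho> M es vs M1 t1; f < length P; exec P (args vs) M1 (P ! f) v M2 t2\<rbrakk>
    \<Longrightarrow> exec P \<rho> M (Call f es) v M2 (1 + t1 + t2)"
| execs_Nil: "execs P \<rho> M [] [] M 0"
| execs_Cons: "\<lbrakk>exec P \<rho> M e v M1 t1; execs P \<rho> M1 es vs M2 t2\<rbrakk>
    \<Longrightarrow> execs P \<rho> M (e # es) (v # vs) M2 (t1 + t2)"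

text \<open>By determinism, a bound on some run of a request is a bound on its only run.\<close>

inductive_cases exec_ConstE: "exec P \<rho> M (Const_Idx n) v M' t"
inductive_cases exec_ZeroE: "exec P \<rho> M Zero_Qty v M' t"
inductive_cases exec_VarE: "exec P \<rho> M (Var x) v M' t"
inductive_cases exec_BinopE: "exec P \<rho> M (Binop f e1 e2) v M' t"
inductive_cases exec_CondE: "exec P \<rho> M (Cond b e1 e2) v M' t"
inductive_cases exec_BindE: "exec P \<rho> M (Bind x e b) v M' t"
inductive_cases exec_ReadE: "exec P \<rho> M (Read e) v M' t"
inductive_cases exec_WriteE: "exec P \<rho> M (Write e1 e2) v M' t"
inductive_cases exec_CallE: "exec P \<rho> M (Call f es) v M' t"
inductive_cases execs_NilE: "execs P \<rho> M [] vs M' t"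
inductive_cases execs_ConsE: "execs P \<rho> M (e # es) vs M' t"

lemma exec_deterministic:
  "exec P \<rho> M e v M1 t \<Longrightarrow> exec P \<rho> M e v' M1' t' \<Longrightarrow> v' = v \<and> M1' = M1 \<and> t' = t"
  "execs P \<rho> M es vs M1 t \<Longrightarrow> execs P \<rho> M es vs' M1' t' \<Longrightarrow> vs' = vs \<and> M1' = M1 \<and> t' = t"
proof (induction arbitrary: v' M1' t' and vs' M1' t' rule: exec_execs.inducts)
  case (exec_Const \<rho> M n)
  from exec_Const show ?case by (auto elim: exec_ConstE)
next
  case (exec_Zero \<rho> M)
  from exec_Zero show ?case by (auto elim: exec_ZeroE)
next
  case (exec_Var \<rho> x v M)
  from exec_Var show ?case by (auto elim: exec_VarE)
next
  case (exec_Binop \<rho> M e1 v1 M1 t1 e2 v2 M2 t2 f v)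
  from exec_Binop.prems show ?case
    by (elim exec_BinopE) (auto dest!: exec_Binop.IH(2,4) simp: exec_Binop.hyps)
next
  case (exec_Cond \<rho> M b n M1 t1 e1 e2 v M2 t2)
  from exec_Cond.prems show ?case
    by (elim exec_CondE) (auto dest!: exec_Cond.IH(2,4))
next
  case (exec_Bind \<rho> M e v1 M1 t1 x b v M2 t2)
  from exec_Bind.prems show ?case
    by (elim exec_BindE) (auto dest!: exec_Bind.IH(2,4))
next
  case (exec_Read \<rho> M e a M1 t1)
  from exec_Read.prems show ?case
    by (elim exec_ReadE) (auto dest!: exec_Read.IH(2) simp: exec_Read.hyps)
next
  case (exec_Write \<rho> M e1 a M1 t1 e2 v M2 t2)
  from exec_Write.prems exec_Write.hyps show ?case
    by (elim exec_WriteE) (auto dest!: exec_Write.IH(2,4))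
next
  case (exec_Extend \<rho> M e1 a M1 t1 e2 v M2 t2)
  from exec_Extend.prems exec_Extend.hyps show ?case
    by (elim exec_WriteE) (auto dest!: exec_Extend.IH(2,4))
next
  case (exec_Call \<rho> M es vs M1 t1 f v M2 t2)
  from exec_Call.prems show ?case
    by (elim exec_CallE) (auto dest!: exec_Call.IH(2,5))
next
  case (execs_Nil \<rho> M)
  from execs_Nil show ?case by (auto elim: execs_NilE)
next
  case (execs_Cons \<rho> M e v M1 t1 es vs M2 t2)
  from execs_Cons.prems show ?case
    by (elim execs_ConsE) (auto dest!: execs_Cons.IH(2,4))
qed


section \<open>Data structures for interval purchases\<close>

text \<open>
  The program is a fixed finite object; \<open>N\<close> is known to it only as the argument of the
  initialization.
\<close>

record market_ds =
  procedures :: procs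
  init_code :: expr
  purchase_code :: expr
  max_code :: expr
  count_code :: expr

fun serve :: "market_ds \<Rightarrow> request \<Rightarrow> mem \<Rightarrow> val \<Rightarrow> mem \<Rightarrow> nat \<Rightarrow> bool" where
  "serve D (Purchase l r v) M a M' t \<longleftrightarrow>
     exec (procedures D) (args [Idx l, Idx r, Qty v]) M (purchase_code D) a M' t"
| "serve D Query_Max M a M' t \<longleftrightarrow> exec (procedures D) (args []) M (max_code D) a M' t"
| "serve D Query_Count M a M' t \<longleftrightarrow> exec (procedures D) (args []) M (count_code D) a M' t"

definition initialize :: "market_ds \<Rightarrow> nat \<Rightarrow> mem \<Rightarrow> nat \<Rightarrow> bool" where
  "initialize D N M t \<longleftrightarrow> (\<exists>a. exec (procedures D) (args [Idx N]) [] (init_code D) a M t)"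

text \<open>\<open>reaches D N rs M\<close>: after initialization and the requests \<open>rs\<close>, the memory is \<open>M\<close>.\<close>

inductive reaches :: "market_ds \<Rightarrow> nat \<Rightarrow> request list \<Rightarrow> mem \<Rightarrow> bool"
  for D :: market_ds and N :: nat
where
  reaches_init: "initialize D N M t \<Longrightarrow> reaches D N [] M"
| reaches_serve: "\<lbrakk>reaches D N rs M; serve D r M a M' t\<rbrakk> \<Longrightarrow> reaches D N (rs @ [r]) M'"

end

theory Submission
  imports Defs
begin

text \<open>
  Store the increments at interval endpoints, so that \<open>q\<^sub>i\<close> is the sum of the increments at
  endpoints up to \<open>i\<close>: a purchase of \<open>[l, r]\<close> changes only the increments at \<open>l\<close> and \<open>r + 1\<close>. The
  endpoints cut the outcomes into at most \<open>k + 1\<close> segments of constant quantity, which are the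
  leaves of an AVL tree. Each node carries the sum of the increments in its subtree, the maximum of
  the partial sums and the number of outcomes attaining it; these are computed from the children,
  hence survive rotations, and the root answers the queries. An update rebuilds one path, of length
  \<open>O(log k)\<close>, in place.
\<close>

section \<open>Segment trees\<close>

text \<open>A balanced tree over all of \<open>{..<N}\<close> would have depth about
  \<open>log N\<close>. To depend on \<open>k\<close> alone, the keys have to be the endpoints seen
  so far, and then the tree has to be rebalanced as they arrive. A purchase moves whole suffixes of
  quantities, up from \<open>l\<close> and down again from \<open>r + 1\<close>. It still touches
  few nodes because each node measures partial sums from its own left end: a change left of a
  subtree moves all its quantities without touching its words, and the parent accounts for this by
  the single addition \<open>net l + peak r\<close>. Memory linear in \<open>k\<close> leaves no
  room for garbage: splitting a leaf turns its block into the inner node and takes exactly two fresh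
  blocks. The argument therefore follows a tree together with its placement in memory. Runs of the
  program are exhibited, and since \<open>exec\<close> is deterministic they are the only
  ones.\<close>

text \<open>
  \<open>Leaf p a n d\<close> is the segment \<open>{a..<a + n}\<close> with increment \<open>d\<close>; in \<open>Node p l k r\<close> the keys
  below \<open>k\<close> are in \<open>l\<close>. The component \<open>p\<close> is the number of the memory block of the node: rotations
  must reuse blocks, as memory is never reclaimed.
\<close>

datatype seg_tree = Leaf nat nat nat real | Node nat seg_tree nat seg_tree

fun root_block :: "seg_tree \<Rightarrow> nat" where
  "root_block (Leaf p a n d) = p"
| "root_block (Node p l k r) = p"

text \<open>In-order, so that a rotation preserves the list itself and with it the distinctness of
  blocks.\<close>

fun addrs :: "seg_tree \<Rightarrow> nat list" where
  "addrs (Leaf p a n d) = [p]"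
| "addrs (Node p l k r) = addrs l @ p # addrs r"

fun starts :: "seg_tree \<Rightarrow> nat set" where
  "starts (Leaf p a n d) = {a}"
| "starts (Node p l k r) = starts l \<union> starts r"

fun ht :: "seg_tree \<Rightarrow> nat" where
  "ht (Leaf p a n d) = 0"
| "ht (Node p l k r) = Suc (max (ht l) (ht r))"

fun net :: "seg_tree \<Rightarrow> real" where
  "net (Leaf p a n d) = d"
| "net (Node p l k r) = net l + net r"

text \<open>All partial sums start at the left end of the subtree, not of the whole tree.\<close>

fun peak :: "seg_tree \<Rightarrow> real" where
  "peak (Leaf p a n d) = d"
| "peak (Node p l k r) = max (peak l) (net l + peak r)"

fun peak_count :: "seg_tree \<Rightarrow> nat" where
  "peak_count (Leaf p a n d) = n"
| "peak_count (Node p l k r) =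
     (if peak l = peak (Node p l k r) then peak_count l else 0) +
     (if net l + peak r = peak (Node p l k r) then peak_count r else 0)"

fun level :: "seg_tree \<Rightarrow> nat \<Rightarrow> real" where
  "level (Leaf p a n d) i = d"
| "level (Node p l k r) i = (if i < k then level l i else net l + level r i)"

fun tiles :: "nat \<Rightarrow> nat \<Rightarrow> seg_tree \<Rightarrow> bool" where
  "tiles lo hi (Leaf p a n d) \<longleftrightarrow> a = lo \<and> lo < hi \<and> n = hi - lo"
| "tiles lo hi (Node p l k r) \<longleftrightarrow> tiles lo k l \<and> tiles k hi r"

fun avl :: "seg_tree \<Rightarrow> bool" where
  "avl (Leaf p a n d) \<longleftrightarrow> True"
| "avl (Node p l k r) \<longleftrightarrow> ht l \<le> Suc (ht r) \<and> ht r \<le> Suc (ht l) \<and> avl l \<and> avl r"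

definition rot_right :: "nat \<Rightarrow> seg_tree \<Rightarrow> nat \<Rightarrow> seg_tree \<Rightarrow> seg_tree" where
  "rot_right p l k r = (case l of
     Leaf _ _ _ _ \<Rightarrow> Node p l k r
   | Node q ll kl lr \<Rightarrow>
       (if ht ll < ht lr then
          (case lr of
             Leaf _ _ _ _ \<Rightarrow> Node p l k r
           | Node m lrl km lrr \<Rightarrow> Node m (Node q ll kl lrl) km (Node p lrr k r))
        else Node q ll kl (Node p lr k r)))"

definition rot_left :: "nat \<Rightarrow> seg_tree \<Rightarrow> nat \<Rightarrow> seg_tree \<Rightarrow> seg_tree" where
  "rot_left p l k r = (case r of
     Leaf _ _ _ _ \<Rightarrow> Node p l k r
   | Node q rl kr rr \<Rightarrow>
       (if ht rr < ht rl then
          (case rl of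
             Leaf _ _ _ _ \<Rightarrow> Node p l k r
           | Node m rll km rlr \<Rightarrow> Node m (Node p l k rll) km (Node q rlr kr rr))
        else Node q (Node p l k rl) kr rr))"

definition balance :: "nat \<Rightarrow> seg_tree \<Rightarrow> nat \<Rightarrow> seg_tree \<Rightarrow> seg_tree" where
  "balance p l k r =
     (if Suc (ht r) < ht l then rot_right p l k r
      else if Suc (ht l) < ht r then rot_left p l k r
      else Node p l k r)"

text \<open>Blocks \<open>f\<close> and \<open>f + 1\<close> are the first unused ones.\<close>

fun update :: "nat \<Rightarrow> nat \<Rightarrow> real \<Rightarrow> seg_tree \<Rightarrow> seg_tree" where
  "update f x v (Leaf p a n d) =
     (if a = x then Leaf p x n (d + v)
      else Node p (Leaf (Suc f) a (x - a) d) x (Leaf f x (a + n - x) v))"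
| "update f x v (Node p l k r) =
     (if x < k then balance p (update f x v l) k r else balance p l k (update f x v r))"

lemma tiles_less: "tiles lo hi t \<Longrightarrow> lo < hi"
  by (induction t arbitrary: lo hi) (auto, meson less_trans)

section \<open>Invariance under rotations\<close>

lemmas balance_defs = balance_def rot_right_def rot_left_def

lemma addrs_balance [simp]: "addrs (balance p l k r) = addrs l @ p # addrs r"
  by (auto simp: balance_defs split: seg_tree.split)

lemma starts_balance [simp]: "starts (balance p l k r) = starts l \<union> starts r"
  by (auto simp: balance_defs split: seg_tree.split)

lemma net_balance [simp]: "net (balance p l k r) = net l + net r"
  by (auto simp: balance_defs split: seg_tree.split)

lemma tiles_balance [simp]: "tiles lo hi (balance p l k r) \<longleftrightarrow> tiles lo k l \<and> tiles k hi r"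
  by (auto simp: balance_defs split: seg_tree.split)

text \<open>Before and after the rotation, \<open>i\<close> is tested against the same keys in a
  different order. \<open>tiles\<close> makes these keys increasing, so \<open>i\<close> reaches the
  same subtree, and the \<open>net\<close> terms collected on the way have the same sum.\<close>

lemma level_rot_right:
  assumes "tiles lo k l"
  shows "level (rot_right p l k r) i = level (Node p l k r) i"
proof (cases l)
  case Leaf
  then show ?thesis by (simp add: rot_right_def)
next
  case (Node q ll kl lr)
  with assms have "kl < k"
    by (auto dest: tiles_less)
  moreover have "kl < km \<and> km < k" if "lr = Node m lrl km lrr" for m lrl km lrr
    using that assms Node by (auto dest: tiles_less)
  ultimately show ?thesis
    using Node by (cases lr) (auto simp: rot_right_def)
qed

lemma level_rot_left:
  assumes "tiles k hi r"
  shows "level (rot_left p l k r) i = level (Node p l k r) i"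
proof (cases r)
  case Leaf
  then show ?thesis by (simp add: rot_left_def)
next
  case (Node q rl kr rr)
  with assms have "k < kr"
    by (auto dest: tiles_less)
  moreover have "k < km \<and> km < kr" if "rl = Node m rll km rlr" for m rll km rlr
    using that assms Node by (auto dest: tiles_less)
  ultimately show ?thesis
    using Node by (cases rl) (auto simp: rot_left_def)
qed

lemma level_balance:
  "tiles lo k l \<Longrightarrow> tiles k hi r \<Longrightarrow> level (balance p l k r) i = level (Node p l k r) i"
  unfolding balance_def using level_rot_right level_rot_left by simp

text \<open>The height \<open>Suc (ht l)\<close> arises when the children of \<open>l\<close> are
  equally high. Allowing it means that nothing has to be known about how the imbalance came
  about.\<close>

lemma avl_rot_right:
  assumes "avl l" "avl r" "ht l = ht r + 2"
  shows "avl (rot_right p l k r) \<and> ht (rot_right p l k r) \<in> {ht l, Suc (ht l)}"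
proof (cases l)
  case (Node q ll kl lr)
  with assms show ?thesis
    by (cases lr) (auto simp: rot_right_def max_def split: if_splits)
qed (use assms in simp)

lemma avl_rot_left:
  assumes "avl l" "avl r" "ht r = ht l + 2"
  shows "avl (rot_left p l k r) \<and> ht (rot_left p l k r) \<in> {ht r, Suc (ht r)}"
proof (cases r)
  case (Node q rl kr rr)
  with assms show ?thesis
    by (cases rl) (auto simp: rot_left_def max_def split: if_splits)
qed (use assms in simp)

lemma avl_balance:
  assumes "avl l" "avl r" "ht l \<le> ht r + 2" "ht r \<le> ht l + 2"
  shows "avl (balance p l k r)"
    and "ht (balance p l k r) \<le> Suc (max (ht l) (ht r))"
    and "max (ht l) (ht r) \<le> ht (balance p l k r)"
    and "ht l \<le> Suc (ht r) \<Longrightarrow> ht r \<le> Suc (ht l) \<Longrightarrow> ht (balance p l k r) = Suc (max (ht l) (ht r))"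
proof -
  consider "ht l = ht r + 2" | "ht r = ht l + 2" | "ht l \<le> Suc (ht r)" "ht r \<le> Suc (ht l)"
    using assms by linarith
  note split = this
  show "avl (balance p l k r)" "ht (balance p l k r) \<le> Suc (max (ht l) (ht r))"
    "max (ht l) (ht r) \<le> ht (balance p l k r)"
    by (cases rule: split;
        use assms avl_rot_right[of l r p k] avl_rot_left[of l r p k] in \<open>auto simp: balance_def\<close>)+
qed (simp add: balance_def)

section \<open>Effect of an update at one endpoint\<close>

lemma net_update [simp]: "net (update f x v t) = net t + v"
  by (induction t) auto

lemma tiles_update: "tiles lo hi t \<Longrightarrow> lo \<le> x \<Longrightarrow> x < hi \<Longrightarrow> tiles lo hi (update f x v t)"
  by (induction t arbitrary: lo hi) auto

text \<open>Since \<open>level\<close> adds \<open>net l\<close> right of a key, raising one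
  increment lifts the whole suffix. When a leaf is split, the old increment \<open>d\<close> stays
  in the left part and the right part gets just \<open>v\<close>, which makes \<open>d + v\<close>
  there.\<close>

lemma level_update:
  "tiles lo hi t \<Longrightarrow> lo \<le> x \<Longrightarrow> x < hi \<Longrightarrow> lo \<le> i \<Longrightarrow> i < hi \<Longrightarrow>
   level (update f x v t) i = level t i + (if x \<le> i then v else 0)"
proof (induction t arbitrary: lo hi)
  case (Leaf p a n d)
  then show ?case by auto
next
  case (Node p l k r)
  then have t: "tiles lo k l" "tiles k hi r"
    by auto
  show ?case
  proof (cases "x < k")
    case True
    then have "tiles lo k (update f x v l)"
      using Node.prems t by (intro tiles_update) auto
    then show ?thesis
      using Node t True by (auto simp: level_balance)
  next
    case False
    then have "tiles k hi (update f x v r)"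
      using Node.prems t by (intro tiles_update) auto
    then show ?thesis
      using Node t False by (auto simp: level_balance)
  qed
qed

lemma avl_update:
  "avl t \<Longrightarrow>
   avl (update f x v t) \<and> ht t \<le> ht (update f x v t) \<and> ht (update f x v t) \<le> Suc (ht t)"
proof (induction t)
  case (Leaf p a n d)
  then show ?case by auto
next
  case (Node p l k r)
  show ?case
  proof (cases "x < k")
    case True
    with Node have "ht (update f x v l) = ht l \<or> ht (update f x v l) = Suc (ht l)"
      by auto
    \<comment> \<open>Without a rotation the height is exact. A rotation needs
      \<open>ht l = Suc (ht r)\<close> and growth of \<open>l\<close>; then the new maximum
      \<open>Suc (ht l)\<close> is the old height of the node, and the two-sided bound is the
      claim.\<close>
    with True Node avl_balance[of "update f x v l" r p k] show ?thesis
      by (cases "ht l \<le> ht r") auto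
  next
    case False
    with Node have "ht (update f x v r) = ht r \<or> ht (update f x v r) = Suc (ht r)"
      by auto
    with False Node avl_balance[of l "update f x v r" p k] show ?thesis
      by (cases "ht l \<le> ht r") auto
  qed
qed

section \<open>Numbers of segments and blocks, and the height\<close>

lemma starts_update:
  "tiles lo hi t \<Longrightarrow> lo \<le> x \<Longrightarrow> x < hi \<Longrightarrow> starts (update f x v t) = insert x (starts t)"
  by (induction t arbitrary: lo hi) auto

lemma tiles_starts: "tiles lo hi t \<Longrightarrow> starts t \<subseteq> {lo..<hi}"
  by (induction t arbitrary: lo hi) (fastforce dest: tiles_less)+

lemma finite_starts [simp]: "finite (starts t)"
  by (induction t) auto

lemma card_starts_pos: "0 < card (starts t)"
  by (induction t) (auto simp: card_gt_0_iff)

lemma card_starts_Node: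
  assumes "tiles lo hi (Node p l k r)"
  shows "card (starts (Node p l k r)) = card (starts l) + card (starts r)"
proof -
  have "starts l \<inter> starts r = {}"
    using assms tiles_starts[of lo k l] tiles_starts[of k hi r] by fastforce
  then show ?thesis
    by (simp add: card_Un_disjoint)
qed

text \<open>A binary tree with \<open>c\<close> leaves has \<open>2 * c - 1\<close> nodes, and
  \<open>tiles\<close> makes the starts of distinct leaves distinct. The linear space bound comes
  from here.\<close>

lemma length_addrs: "tiles lo hi t \<Longrightarrow> Suc (length (addrs t)) = 2 * card (starts t)"
proof (induction t arbitrary: lo hi)
  case (Leaf p a n d)
  then show ?case by simp
next
  case (Node p l k r)
  then show ?case
    using card_starts_Node[OF Node.prems] by fastforce
qed

text \<open>In a tree of height \<open>n + 2\<close> both children have height at least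
  \<open>n\<close>, so their leaf counts \<open>a\<close> and \<open>b\<close> have squares of at
  least \<open>2 ^ n\<close>. Then \<open>a * b\<close> is at least \<open>2 ^ n\<close> too, and
  \<open>(a + b)^2\<close> at least \<open>4 * 2 ^ n\<close>. This replaces the Fibonacci estimate;
  a height of twice the binary logarithm is good enough.\<close>

lemma avl_ht: "tiles lo hi t \<Longrightarrow> avl t \<Longrightarrow> 2 ^ ht t \<le> (card (starts t))\<^sup>2"
proof (induction t arbitrary: lo hi)
  case (Leaf p a n d)
  then show ?case by simp
next
  case (Node p l k r)
  let ?a = "card (starts l)" and ?b = "card (starts r)"
  have IH: "2 ^ ht l \<le> ?a\<^sup>2" "2 ^ ht r \<le> ?b\<^sup>2"
    using Node by auto
  show ?case
  proof (cases "max (ht l) (ht r)")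
    case 0
    have "2 \<le> ?a + ?b"
      using card_starts_pos[of l] card_starts_pos[of r] by linarith
    then have "2\<^sup>2 \<le> (?a + ?b)\<^sup>2"
      by (rule power_mono) simp
    then show ?thesis
      using 0 card_starts_Node[OF Node.prems(1)] by simp
  next
    case (Suc n)
    have n: "n \<le> ht l" "n \<le> ht r"
      using Suc Node.prems(2) by (auto simp: max_def split: if_splits)
    have a: "2 ^ n \<le> ?a\<^sup>2" and b: "2 ^ n \<le> ?b\<^sup>2"
      using n IH by (meson order_trans power_increasing one_le_numeral)+
    have "(2 ^ n)\<^sup>2 \<le> (?a * ?b)\<^sup>2"
      unfolding power_mult_distrib power2_eq_square[of "2 ^ n"] by (rule mult_mono[OF a b]) auto
    then have "2 ^ n \<le> ?a * ?b"
      by (rule power2_le_imp_le) simp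
    with a b have "4 * 2 ^ n \<le> (?a + ?b)\<^sup>2"
      by (simp add: power2_sum)
    then show ?thesis
      using Suc card_starts_Node[OF Node.prems(1)] by simp
  qed
qed

text \<open>\<open>f\<close> is meant to count the blocks of the whole tree while \<open>t\<close>
  may be a subtree. The growth, 0 or 2, is written as a difference of lengths, so that the induction
  need not track whether a leaf is split.\<close>

lemma addrs_update:
  assumes "tiles lo hi t" "lo \<le> x" "x < hi" "distinct (addrs t)" "set (addrs t) \<subseteq> {..<f}"
  shows "distinct (addrs (update f x v t)) \<and>
    set (addrs (update f x v t)) \<subseteq> set (addrs t) \<union> {f..<f + (length (addrs (update f x v t)) - length (addrs t))} \<and>
    length (addrs t) \<le> length (addrs (update f x v t))"
  using assms
proof (induction t arbitrary: lo hi)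
  case (Leaf p a n d)
  then show ?case by auto
next
  case (Node p l k r)
  show ?case
  proof (cases "x < k")
    case True
    with Node.IH(1)[of lo k] Node.prems show ?thesis
      by fastforce
  next
    case False
    with Node.IH(2)[of k hi] Node.prems show ?thesis
      by fastforce
  qed
qed

text \<open>The maximisers split at the key. On either side they are those of the child if its peak,
  shifted by \<open>net l\<close> on the right, reaches the peak of the node; otherwise there are
  none. A tie adds both counts.\<close>

lemma peak_level:
  "tiles lo hi t \<Longrightarrow>
   (\<forall>i\<in>{lo..<hi}. level t i \<le> peak t) \<and> (\<exists>i\<in>{lo..<hi}. level t i = peak t) \<and>
   card {i\<in>{lo..<hi}. level t i = peak t} = peak_count t"
proof (induction t arbitrary: lo hi)
  case (Leaf p a n d)
  moreover have "{i. lo \<le> i \<and> i < hi} = {lo..<hi}"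
    by auto
  ultimately show ?case by auto
next
  case (Node p l k r)
  have t: "tiles lo k l" "tiles k hi r"
    using Node.prems by auto
  note less = t[THEN tiles_less]
  let ?t = "Node p l k r"
  let ?A = "{i\<in>{lo..<k}. level l i = peak ?t}" and ?B = "{i\<in>{k..<hi}. net l + level r i = peak ?t}"
  note IHl = Node.IH(1)[OF t(1)] and IHr = Node.IH(2)[OF t(2)]
  have le: "\<forall>i\<in>{lo..<hi}. level ?t i \<le> peak ?t"
    using IHl IHr by (auto simp: le_max_iff_disj)
  have ex: "\<exists>i\<in>{lo..<hi}. level ?t i = peak ?t"
  proof (cases "peak l < net l + peak r")
    case True
    obtain i where "i \<in> {k..<hi}" "level r i = peak r"
      using IHr by blast
    with True less show ?thesis
      by (intro bexI[of _ i]) auto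
  next
    case False
    obtain i where "i \<in> {lo..<k}" "level l i = peak l"
      using IHl by blast
    with False less show ?thesis
      by (intro bexI[of _ i]) auto
  qed
  have "{i\<in>{lo..<hi}. level ?t i = peak ?t} = ?A \<union> ?B"
    using less by auto
  moreover have "?A \<inter> ?B = {}"
    by auto
  ultimately have "card {i\<in>{lo..<hi}. level ?t i = peak ?t} = card ?A + card ?B"
    using card_Un_disjoint[of ?A ?B] by simp
  moreover have "card ?A = (if peak l = peak ?t then peak_count l else 0)"
  proof (cases "peak l = peak ?t")
    case True
    then show ?thesis using IHl by simp
  next
    case False
    then have "peak l < peak ?t" by auto
    then have "?A = {}"
      using IHl by fastforce
    then show ?thesis using False by (simp only: card.empty if_False)
  qed
  moreover have "card ?B = (if net l + peak r = peak ?t then peak_count r else 0)"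
  proof (cases "net l + peak r = peak ?t")
    case True
    then have "?B = {i\<in>{k..<hi}. level r i = peak r}"
      by (metis (lifting) add_left_cancel)
    then show ?thesis
      using IHr unfolding True by simp
  next
    case False
    then have "net l + peak r < peak ?t" by auto
    then have "?B = {}"
      using IHr by fastforce
    then show ?thesis using False by (simp only: card.empty if_False)
  qed
  ultimately show ?case
    using le ex unfolding peak_count.simps by presburger
qed

section \<open>Symbolic execution\<close>

text \<open>A weakest precondition for total correctness; the step count goes to the postcondition,
  so one computation yields result and running time.\<close>

definition wp ::
  "procs \<Rightarrow> env \<Rightarrow> mem \<Rightarrow> expr \<Rightarrow> (val \<Rightarrow> mem \<Rightarrow> nat \<Rightarrow> bool) \<Rightarrow> bool" where
  "wp P \<rho> M e Q \<longleftrightarrow> (\<exists>v M' t. exec P \<rho> M e v M' t \<and> Q v M' t)"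

definition wps ::
  "procs \<Rightarrow> env \<Rightarrow> mem \<Rightarrow> expr list \<Rightarrow> (val list \<Rightarrow> mem \<Rightarrow> nat \<Rightarrow> bool) \<Rightarrow> bool" where
  "wps P \<rho> M es Q \<longleftrightarrow> (\<exists>vs M' t. execs P \<rho> M es vs M' t \<and> Q vs M' t)"

text \<open>Merges overwriting and extending, so that symbolic execution need not branch. It agrees
  with the machine for \<open>a \<le> length M\<close>, a condition kept in the rules below.\<close>

definition write_word :: "mem \<Rightarrow> nat \<Rightarrow> val \<Rightarrow> mem" where
  "write_word M a v = (if a < length M then M[a := v] else M @ [v])"

text \<open>By determinism a known run decides every postcondition; a call already verified can thus
  be rewritten away.\<close>

lemma wp_exec: "exec P \<rho> M e v M' t \<Longrightarrow> wp P \<rho> M e Q \<longleftrightarrow> Q v M' t"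
  unfolding wp_def using exec_deterministic(1) by blast

text \<open>Step counts stay numerals only if the simplifier does not introduce \<open>Suc\<close>.\<close>

declare One_nat_def [simp del] plus_1_eq_Suc [simp del] add_2_eq_Suc' [simp del]

lemma exec_iff:
  "exec P \<rho> M (Const_Idx n) v M' t \<longleftrightarrow> v = Idx n \<and> M' = M \<and> t = 1"
  "exec P \<rho> M Zero_Qty v M' t \<longleftrightarrow> v = Qty 0 \<and> M' = M \<and> t = 1"
  "exec P \<rho> M (Var x) v M' t \<longleftrightarrow> \<rho> x = Some v \<and> M' = M \<and> t = 1"
  "exec P \<rho> M (Binop f e1 e2) v M' t \<longleftrightarrow>
     (\<exists>v1 M1 t1 v2 t2. exec P \<rho> M e1 v1 M1 t1 \<and> exec P \<rho> M1 e2 v2 M' t2 \<and>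
        apply_binop f v1 v2 = Some v \<and> t = 1 + t1 + t2)"
  "exec P \<rho> M (Cond e e1 e2) v M' t \<longleftrightarrow>
     (\<exists>n M1 t1 t2. exec P \<rho> M e (Idx n) M1 t1 \<and>
        exec P \<rho> M1 (if n = 0 then e2 else e1) v M' t2 \<and> t = 1 + t1 + t2)"
  "exec P \<rho> M (Bind x e b) v M' t \<longleftrightarrow>
     (\<exists>v1 M1 t1 t2. exec P \<rho> M e v1 M1 t1 \<and> exec P (\<rho>(x := Some v1)) M1 b v M' t2 \<and>
        t = 1 + t1 + t2)"
  "exec P \<rho> M (Read e) v M' t \<longleftrightarrow>
     (\<exists>a t1. exec P \<rho> M e (Idx a) M' t1 \<and> a < length M' \<and> v = M' ! a \<and> t = 1 + t1)"
  "exec P \<rho> M (Write e1 e2) v M' t \<longleftrightarrow>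
     (\<exists>a M1 t1 M2 t2. exec P \<rho> M e1 (Idx a) M1 t1 \<and> exec P \<rho> M1 e2 v M2 t2 \<and>
        a \<le> length M2 \<and> M' = write_word M2 a v \<and> t = 1 + t1 + t2)"
  "exec P \<rho> M (Call g es) v M' t \<longleftrightarrow>
     (\<exists>vs M1 t1 t2. execs P \<rho> M es vs M1 t1 \<and> g < length P \<and>
        exec P (args vs) M1 (P ! g) v M' t2 \<and> t = 1 + t1 + t2)"
  "execs P \<rho> M [] vs M' t \<longleftrightarrow> vs = [] \<and> M' = M \<and> t = 0"
  "execs P \<rho> M (e # es) vs M' t \<longleftrightarrow>
     (\<exists>v M1 t1 ws t2. exec P \<rho> M e v M1 t1 \<and> execs P \<rho> M1 es ws M' t2 \<and>
        vs = v # ws \<and> t = t1 + t2)"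
  subgoal by (metis exec_Const exec_ConstE)
  subgoal by (metis exec_Zero exec_ZeroE)
  subgoal by (metis exec_Var exec_VarE)
  subgoal
    by (rule iffI, erule exec_BinopE, (intro exI conjI, (assumption | simp)+),
        clarify, rule exec_Binop; assumption)
  subgoal
    by (rule iffI, erule exec_CondE, (intro exI conjI, (assumption | simp)+),
        clarify, rule exec_Cond; assumption)
  subgoal
    by (rule iffI, erule exec_BindE, (intro exI conjI, (assumption | simp)+),
        clarify, rule exec_Bind; assumption)
  subgoal
    by (rule iffI, erule exec_ReadE, (intro exI conjI, (assumption | simp)+),
        clarify, rule exec_Read; assumption)
  subgoal
    unfolding write_word_def
    by (fastforce intro: exec_Write exec_Extend elim!: exec_WriteE split: if_splits)
  subgoal
    by (rule iffI, erule exec_CallE, (intro exI conjI, (assumption | simp)+),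
        clarify, rule exec_Call; assumption)
  subgoal by (metis execs_Nil execs_NilE)
  subgoal
    by (rule iffI, erule execs_ConsE, (intro exI conjI, (assumption | simp)+),
        clarify, rule execs_Cons; assumption)
  done

text \<open>The postcondition of a subexpression is the precondition of what remains to be
  evaluated. Used as rewrite rules, these equations run the code.\<close>

lemma wp_simps [simp]:
  "wp P \<rho> M (Const_Idx n) Q \<longleftrightarrow> Q (Idx n) M 1"
  "wp P \<rho> M Zero_Qty Q \<longleftrightarrow> Q (Qty 0) M 1"
  "wp P \<rho> M (Var x) Q \<longleftrightarrow> (\<exists>v. \<rho> x = Some v \<and> Q v M 1)"
  "wp P \<rho> M (Binop f e1 e2) Q \<longleftrightarrow>
     wp P \<rho> M e1 (\<lambda>v1 M1 t1. wp P \<rho> M1 e2 (\<lambda>v2 M2 t2.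
       \<exists>v. apply_binop f v1 v2 = Some v \<and> Q v M2 (1 + t1 + t2)))"
  "wp P \<rho> M (Cond e e1 e2) Q \<longleftrightarrow>
     wp P \<rho> M e (\<lambda>v M1 t1. \<exists>n. v = Idx n \<and>
       wp P \<rho> M1 (if n = 0 then e2 else e1) (\<lambda>v M2 t2. Q v M2 (1 + t1 + t2)))"
  "wp P \<rho> M (Bind x e b) Q \<longleftrightarrow>
     wp P \<rho> M e (\<lambda>v1 M1 t1. wp P (\<rho>(x := Some v1)) M1 b (\<lambda>v M2 t2. Q v M2 (1 + t1 + t2)))"
  "wp P \<rho> M (Read e) Q \<longleftrightarrow>
     wp P \<rho> M e (\<lambda>v M1 t. \<exists>a. v = Idx a \<and> a < length M1 \<and> Q (M1 ! a) M1 (1 + t))"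
  "wp P \<rho> M (Write e1 e2) Q \<longleftrightarrow>
     wp P \<rho> M e1 (\<lambda>v1 M1 t1. wp P \<rho> M1 e2 (\<lambda>v M2 t2.
       \<exists>a. v1 = Idx a \<and> a \<le> length M2 \<and> Q v (write_word M2 a v) (1 + t1 + t2)))"
  "wp P \<rho> M (Call g es) Q \<longleftrightarrow>
     wps P \<rho> M es (\<lambda>vs M1 t1. g < length P \<and>
       wp P (args vs) M1 (P ! g) (\<lambda>v M2 t2. Q v M2 (1 + t1 + t2)))"
  "wps P \<rho> M [] R \<longleftrightarrow> R [] M 0"
  "wps P \<rho> M (e # es) R \<longleftrightarrow>
     wp P \<rho> M e (\<lambda>v M1 t1. wps P \<rho> M1 es (\<lambda>vs M2 t2. R (v # vs) M2 (t1 + t2)))"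
  unfolding wp_def wps_def exec_iff
  subgoal by simp
  subgoal by simp
  subgoal by simp
  subgoal
    by (rule iffI, (clarify, intro exI conjI, (assumption | rule refl)+),
        (clarify, intro exI conjI, (assumption | rule refl)+))
  subgoal
    by (rule iffI, (clarify, intro exI conjI, (assumption | rule refl)+),
        (clarify, intro exI conjI, (assumption | rule refl)+))
  subgoal
    by (rule iffI, (clarify, intro exI conjI, (assumption | rule refl)+),
        (clarify, intro exI conjI, (assumption | rule refl)+))
  subgoal
    by (rule iffI, (clarify, intro exI conjI, (assumption | rule refl)+),
        (clarify, intro exI conjI, (assumption | rule refl)+))
  subgoal
    by (rule iffI, (clarify, intro exI conjI, (assumption | rule refl)+),
        (clarify, intro exI conjI, (assumption | rule refl)+))
  subgoal
    by (rule iffI, (clarify, intro exI conjI, (assumption | rule refl)+),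
        (clarify, intro exI conjI, (assumption | rule refl)+))
  subgoal by simp
  subgoal
    by (rule iffI, (clarify, intro exI conjI, (assumption | rule refl)+),
        (clarify, intro exI conjI, (assumption | rule refl)+))
  done

text \<open>Makes up for keeping \<open>1\<close> from being rewritten to
  \<open>Suc 0\<close>.\<close>

lemma nth_Cons_1 [simp]: "(x # xs) ! 1 = xs ! 0"
  by (simp add: One_nat_def)

section \<open>Trees in memory\<close>

text \<open>Words 0, 1 and 2 hold \<open>N\<close>, the address of the root and the first unused address.\<close>

definition loc :: "nat \<Rightarrow> nat" where
  "loc i = 7 * i + 3"

text \<open>A block beyond the end of the memory yields a shorter list, so
  \<open>length (node M i) = 7\<close> also certifies that its reads are legal.\<close>

definition node :: "mem \<Rightarrow> nat \<Rightarrow> val list" where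
  "node M i = take 7 (drop (loc i) M)"

text \<open>Covers overwriting and appending alike: at the end of the memory the \<open>drop\<close>
  part is empty.\<close>

definition put :: "mem \<Rightarrow> nat \<Rightarrow> val list \<Rightarrow> mem" where
  "put M a vs = take a M @ vs @ drop (a + length vs) M"

lemma loc_Suc [simp]: "loc (Suc i) = loc i + 7"
  by (simp add: loc_def)

lemma loc_ge: "3 \<le> loc i"
  by (simp add: loc_def)

lemma loc_lengthD: "i < f \<Longrightarrow> length M = loc f \<Longrightarrow> loc i + 7 \<le> length M"
  by (simp add: loc_def)

lemma length_put: "length (put M a vs) = max (length M) (min a (length M) + length vs)"
  by (simp add: put_def)

lemma put_snoc:
  assumes "a \<le> length M"
  shows "write_word (put M a vs) (a + length vs) v = put M a (vs @ [v])"
  using assms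
  by (auto simp: write_word_def put_def list_update_append Cons_nth_drop_Suc[symmetric])

lemma put_single: "a \<le> length M \<Longrightarrow> write_word M a v = put M a [v]"
  using put_snoc[of a M "[]" v] by (simp add: put_def)

lemma node_nth: "loc i + 7 \<le> length M \<Longrightarrow> j < 7 \<Longrightarrow> M ! (loc i + j) = node M i ! j"
  by (simp add: node_def)

lemma node_put_same:
  assumes "loc i \<le> length M" "length vs = 7"
  shows "node (put M (loc i) vs) i = vs"
  using assms by (simp add: node_def put_def)

lemma node_put_other:
  assumes "loc i \<le> length M" "length vs = 7" "i \<noteq> j"
  shows "node (put M (loc i) vs) j = node M j"
proof (cases "i < j")
  case True
  with assms show ?thesis
    by (auto simp: node_def put_def loc_def add.commute)
next
  case False
  with assms have "loc j + 7 \<le> loc i"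
    by (simp add: loc_def)
  with assms show ?thesis
    by (simp add: node_def put_def take_drop flip: drop_take)
qed

lemma put_header: "j < 3 \<Longrightarrow> loc i \<le> length M \<Longrightarrow> put M (loc i) vs ! j = M ! j"
  using loc_ge[of i] by (simp add: put_def nth_append)

lemma node_header: "j < 3 \<Longrightarrow> node (M[j := v]) i = node M i"
  using loc_ge[of i] by (simp add: node_def)

text \<open>The height in word 0 doubles as the leaf tag, as only leaves have height 0. Leaves are
  padded because a split turns their block into that of an inner node.\<close>

fun words :: "seg_tree \<Rightarrow> val list" where
  "words (Leaf p a n d) = [Idx 0, Idx a, Qty d, Qty d, Idx n, Idx 0, Idx 0]"
| "words (Node p l k r) =
     [Idx (max (ht l) (ht r) + 1), Idx k, Qty (net (Node p l k r)), Qty (peak (Node p l k r)),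
      Idx (peak_count (Node p l k r)), Idx (loc (root_block l)), Idx (loc (root_block r))]"

fun stored :: "mem \<Rightarrow> seg_tree \<Rightarrow> bool" where
  "stored M (Leaf p a n d) \<longleftrightarrow> node M p = words (Leaf p a n d)"
| "stored M (Node p l k r) \<longleftrightarrow> node M p = words (Node p l k r) \<and> stored M l \<and> stored M r"

lemma length_words [simp]: "length (words t) = 7"
  by (cases t) auto

lemma words_nth [simp]:
  "words t ! 0 = Idx (ht t)" "words t ! 2 = Qty (net t)" "words t ! 3 = Qty (peak t)"
  "words t ! 4 = Idx (peak_count t)"
  by (cases t; simp add: One_nat_def)+

lemma stored_root: "stored M t \<Longrightarrow> node M (root_block t) = words t"
  by (cases t) auto

lemma stored_cong: "(\<And>i. i \<in> set (addrs t) \<Longrightarrow> node M' i = node M i) \<Longrightarrow> stored M' t \<longleftrightarrow> stored M t"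
  by (induction t) auto

lemma node_lengthD: "length (node M i) = 7 \<Longrightarrow> loc i + 7 \<le> length M"
  by (auto simp: node_def)

lemma args_apply [simp]: "args vs i = (if i < length vs then Some (vs ! i) else None)"
  by (simp add: args_def)

definition fld :: "nat \<Rightarrow> nat \<Rightarrow> expr" where
  "fld x j = Read (Binop Add (Var x) (Const_Idx j))"

lemma wp_fld:
  assumes "\<rho> x = Some (Idx (loc i))" "length (node M i) = 7" "j < 7"
  shows "wp P \<rho> M (fld x j) Q \<longleftrightarrow> Q (node M i ! j) M 4"
  using assms node_lengthD[OF assms(2)] by (simp add: fld_def node_nth)

definition offset :: "expr \<Rightarrow> nat \<Rightarrow> expr" where
  "offset e n = Binop Add e (Const_Idx n)"

section \<open>The procedures\<close>

text \<open>Sequencing is expressed by binding the dummy variable 8. The words are written in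
  ascending order because memory can grow only at its end.\<close>

definition store_code :: expr where
  "store_code =
     Bind 8 (Write (Var 0) (Var 1)) (
     Bind 8 (Write (offset (Var 0) 1) (Var 2)) (
     Bind 8 (Write (offset (Var 0) 2) (Var 3)) (
     Bind 8 (Write (offset (Var 0) 3) (Var 4)) (
     Bind 8 (Write (offset (Var 0) 4) (Var 5)) (
     Bind 8 (Write (offset (Var 0) 5) (Var 6)) (
     Bind 8 (Write (offset (Var 0) 6) (Var 7)) (
     Var 0)))))))"

text \<open>In the next two procedures, variables 0 to 3 hold \<open>p\<close>, \<open>l\<close>, \<open>k\<close>, \<open>r\<close> of \<open>Node p l k r\<close>.\<close>

definition node_code :: expr where
  "node_code =
     Bind 4 (fld 1 3) (
     Bind 5 (Binop Add (fld 1 2) (fld 3 3)) (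
     Bind 6 (Cond (Binop Less (Var 4) (Var 5)) (Var 5) (Var 4)) (
     Bind 7 (fld 1 4) (
     Bind 8 (fld 3 4) (
     Call 0 [
       Var 0,
       offset (Cond (Binop Less (fld 1 0) (fld 3 0)) (fld 3 0) (fld 1 0)) 1,
       Var 2,
       Binop Add (fld 1 2) (fld 3 2),
       Var 6,
       Binop Add (Cond (Binop Equal (Var 4) (Var 6)) (Var 7) (Const_Idx 0))
                 (Cond (Binop Equal (Var 5) (Var 6)) (Var 8) (Const_Idx 0)),
       Var 1,
       Var 3])))))"

definition balance_code :: expr where
  "balance_code =
     Cond (Binop Less (offset (fld 3 0) 1) (fld 1 0))
       (Bind 6 (fld 1 5) (Bind 7 (fld 1 6) (Bind 8 (fld 1 1) (
        Cond (Binop Less (fld 6 0) (fld 7 0))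
          (Bind 9 (fld 7 1) (Bind 10 (fld 7 5) (Bind 11 (fld 7 6) (
           Call 1 [Var 7, Call 1 [Var 1, Var 6, Var 8, Var 10], Var 9,
             Call 1 [Var 0, Var 11, Var 2, Var 3]]))))
          (Call 1 [Var 1, Var 6, Var 8, Call 1 [Var 0, Var 7, Var 2, Var 3]])))))
       (Cond (Binop Less (offset (fld 1 0) 1) (fld 3 0))
         (Bind 6 (fld 3 5) (Bind 7 (fld 3 6) (Bind 8 (fld 3 1) (
          Cond (Binop Less (fld 7 0) (fld 6 0))
            (Bind 9 (fld 6 1) (Bind 10 (fld 6 5) (Bind 11 (fld 6 6) (
             Call 1 [Var 6, Call 1 [Var 0, Var 1, Var 2, Var 10], Var 9,
               Call 1 [Var 3, Var 11, Var 8, Var 7]]))))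
            (Call 1 [Var 3, Call 1 [Var 0, Var 1, Var 2, Var 6], Var 8, Var 7])))))
         (Call 1 [Var 0, Var 1, Var 2, Var 3]))"

text \<open>Variables 0 to 2 hold the address of the root, \<open>x\<close> and \<open>v\<close>. In
  a split, the block at the free address is filled before the one behind it, again because memory
  grows at its end; the old leaf is overwritten last, after its fields have been read.\<close>

definition update_code :: expr where
  "update_code =
     Cond (fld 0 0)
       (Cond (Binop Less (Var 1) (fld 0 1))
         (Call 2 [Var 0, Call 3 [fld 0 5, Var 1, Var 2], fld 0 1, fld 0 6])
         (Call 2 [Var 0, fld 0 5, fld 0 1, Call 3 [fld 0 6, Var 1, Var 2]]))
       (Cond (Binop Equal (fld 0 1) (Var 1))
         (Bind 3 (Binop Add (fld 0 2) (Var 2))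
           (Call 0 [Var 0, Const_Idx 0, Var 1, Var 3, Var 3, fld 0 4, Const_Idx 0, Const_Idx 0]))
         (Bind 3 (Read (Const_Idx 2)) (
          Bind 4 (Call 0 [Var 3, Const_Idx 0, Var 1, Var 2, Var 2,
            Binop Sub (Binop Add (fld 0 1) (fld 0 4)) (Var 1), Const_Idx 0, Const_Idx 0]) (
          Bind 5 (Call 0 [offset (Var 3) 7, Const_Idx 0, fld 0 1, fld 0 2, fld 0 2,
            Binop Sub (Var 1) (fld 0 1), Const_Idx 0, Const_Idx 0]) (
          Bind 6 (Write (Const_Idx 2) (offset (Var 3) 14)) (
          Call 1 [Var 0, Var 5, Var 1, Var 4]))))))"

definition market_procs :: procs where
  "market_procs = [store_code, node_code, balance_code, update_code]"

lemma market_procs_simps [simp]: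
  "market_procs ! 0 = store_code"
  "market_procs ! 1 = node_code"
  "market_procs ! 2 = balance_code"
  "market_procs ! 3 = update_code"
  "length market_procs = 4"
  by (simp_all add: market_procs_def)

section \<open>Correctness and running time of the procedures\<close>

lemma wp_offset [simp]:
  "wp P \<rho> M (offset e n) Q \<longleftrightarrow> wp P \<rho> M e (\<lambda>v M' t. \<exists>m. v = Idx m \<and> Q (Idx (m + n)) M' (1 + t + 1))"
proof -
  have "(\<exists>w. apply_binop Add v (Idx n) = Some w \<and> R w) \<longleftrightarrow> (\<exists>m. v = Idx m \<and> R (Idx (m + n)))" for v R
    by (cases v) auto
  then show ?thesis
    by (simp add: offset_def)
qed

lemma wp_store:
  assumes "a \<le> length M"
  shows "wp P (args [Idx a, v1, v2, v3, v4, v5, v6, v7]) M store_code Q \<longleftrightarrow>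
    Q (Idx a) (put M a [v1, v2, v3, v4, v5, v6, v7]) 41"
proof -
  have snoc: "write_word (put M a vs) b v = put M a (vs @ [v])" if "b = a + length vs" for b vs v
    using put_snoc[OF assms] that by simp
  have len: "a + j \<le> length (put M a vs)" if "j \<le> length vs" for j vs
    using assms that by (simp add: length_put)
  show ?thesis
    using assms
    by (simp add: store_code_def put_single[OF assms] snoc len)
qed

text \<open>The two branches of each conditional cost the same, so the step count is exact and the
  equivalence can serve as a rewrite rule.\<close>

lemma wp_node:
  assumes "node M (root_block l) = words l" "node M (root_block r) = words r" "loc p \<le> length M"
  shows "wp market_procs (args [Idx (loc p), Idx (loc (root_block l)), Idx k, Idx (loc (root_block r))])
      M node_code Q \<longleftrightarrow> Q (Idx (loc p)) (put M (loc p) (words (Node p l k r))) 114"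
  using assms
  by (simp add: node_code_def wp_fld wp_store max_def)

definition stamp :: "mem \<Rightarrow> nat \<Rightarrow> seg_tree \<Rightarrow> mem" where
  "stamp M p t = put M (loc p) (words t)"

lemma stamp_simps [simp]:
  assumes "p < f" "length M = loc f"
  shows "length (stamp M p t) = loc f"
    and "node (stamp M p t) p = words t"
    and "q \<noteq> p \<Longrightarrow> node (stamp M p t) q = node M q"
    and "j < 3 \<Longrightarrow> stamp M p t ! j = M ! j"
  using assms loc_lengthD[of p f M]
  by (simp_all add: stamp_def length_put node_put_same node_put_other put_header)

lemma stored_stamp:
  assumes "p < f" "length M = loc f" "p \<notin> set (addrs t)"
  shows "stored (stamp M p s) t \<longleftrightarrow> stored M t"
  using assms by (intro stored_cong) (metis stamp_simps(3))

lemma root_in_addrs [simp]: "root_block t \<in> set (addrs t)"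
  by (cases t) auto

lemma notin_addrs_root: "p \<notin> set (addrs t) \<Longrightarrow> root_block t \<noteq> p"
  using root_in_addrs by metis

definition reshaped :: "mem \<Rightarrow> nat \<Rightarrow> nat set \<Rightarrow> seg_tree \<Rightarrow> mem \<Rightarrow> bool" where
  "reshaped M f X t M' \<longleftrightarrow> stored M' t \<and> length M' = loc f \<and> (\<forall>j<3. M' ! j = M ! j) \<and>
     (\<forall>i. i \<notin> X \<longrightarrow> node M' i = node M i)"

text \<open>The code reads the keys and addresses to be rearranged before it overwrites the first
  block. Each case is then a chain of stamps, and disjointness of the blocks shows that none of them
  spoils a subtree still in use.\<close>

lemma wp_balance:
  assumes st: "stored M l" "stored M r" and d: "distinct (addrs (Node p l k r))"
    and sub: "set (addrs (Node p l k r)) \<subseteq> {..<f}" and len: "length M = loc f"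
  shows "wp market_procs (args [Idx (loc p), Idx (loc (root_block l)), Idx k, Idx (loc (root_block r))])
      M balance_code (\<lambda>v M' t. v = Idx (loc (root_block (balance p l k r))) \<and> t \<le> 1000 \<and>
    reshaped M f (set (addrs (Node p l k r))) (balance p l k r) M')" (is "wp _ _ _ _ ?Q")
proof -
  have loc_le: "loc i \<le> loc f" if "i < f" for i
    using that by (simp add: loc_def)
  have p: "p < f" "p \<notin> set (addrs l)" "p \<notin> set (addrs r)"
    using d sub by auto
  note roots = st[THEN stored_root]
  note stamp = stamp_simps[where f = f] stored_stamp[where f = f] loc_le len notin_addrs_root
  note wp_node = wp_node[folded stamp_def]
  consider (right) "ht r + 1 < ht l" | (left) "ht l + 1 < ht r" "\<not> ht r + 1 < ht l"
    | (none) "\<not> ht r + 1 < ht l" "\<not> ht l + 1 < ht r"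
    by blast
  then show ?thesis
  proof cases
    case right
    then obtain q ll kl lr where l: "l = Node q ll kl lr"
      by (cases l) auto
    have q: "q < f" "q \<noteq> p" "q \<notin> set (addrs ll)" "q \<notin> set (addrs lr)" "q \<notin> set (addrs r)"
      and pl: "p \<notin> set (addrs ll)" "p \<notin> set (addrs lr)"
      using d sub unfolding l by auto
    have stl: "stored M ll" "stored M lr"
      using st unfolding l by auto
    note rootsl = stl[THEN stored_root]
    show ?thesis
    proof (cases "ht ll < ht lr")
      case True
      then obtain m lrl km lrr where lr: "lr = Node m lrl km lrr"
        by (cases lr) auto
      have m: "m < f" "m \<noteq> p" "m \<noteq> q" "m \<notin> set (addrs ll)" "m \<notin> set (addrs lrl)"
          "m \<notin> set (addrs lrr)" "m \<notin> set (addrs r)"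
        and pq: "p \<notin> set (addrs lrl)" "p \<notin> set (addrs lrr)" "q \<notin> set (addrs lrl)" "q \<notin> set (addrs lrr)"
        using d sub unfolding l lr by auto
      have stm: "stored M lrl" "stored M lrr"
        using stl unfolding lr by auto
      note rootsm = stm[THEN stored_root]
      let ?L = "Node q ll kl lrl" and ?R = "Node p lrr k r"
      \<comment> \<open>The memories in order of evaluation: the nested calls build both new
        children before the new root in block \<open>m\<close>.\<close>
      let ?M1 = "stamp M q ?L"
      let ?M2 = "stamp ?M1 p ?R"
      let ?t = "Node m ?L km ?R"
      have b: "balance p l k r = ?t"
        using right True by (simp add: balance_defs l lr)
      have "reshaped M f (set (addrs (Node p l k r))) ?t (stamp ?M2 m ?t)"
        using p q pl m pq st stl stm unfolding reshaped_def l lr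
        by (simp add: stamp)
      then show ?thesis
        unfolding b
        using right True p q pl m pq st stl stm roots rootsl rootsm
          wp_node[of M ll lrl q kl] wp_node[of ?M1 lrr r p k] wp_node[of ?M2 ?L ?R m km]
        by (simp add: balance_code_def wp_fld stamp l lr)
    next
      case False
      let ?R = "Node p lr k r"
      let ?M1 = "stamp M p ?R"
      let ?t = "Node q ll kl ?R"
      have b: "balance p l k r = ?t"
        using right False by (simp add: balance_defs l)
      have "reshaped M f (set (addrs (Node p l k r))) ?t (stamp ?M1 q ?t)"
        using p q pl st stl unfolding reshaped_def l
        by (simp add: stamp)
      then show ?thesis
        unfolding b
        using right False p q pl st stl roots rootsl
          wp_node[of M lr r p k] wp_node[of ?M1 ll ?R q kl]
        by (simp add: balance_code_def wp_fld stamp l)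
    qed
  next
    case left
    then obtain q rl kr rr where r: "r = Node q rl kr rr"
      by (cases r) auto
    have q: "q < f" "q \<noteq> p" "q \<notin> set (addrs rl)" "q \<notin> set (addrs rr)" "q \<notin> set (addrs l)"
      and pr: "p \<notin> set (addrs rl)" "p \<notin> set (addrs rr)"
      using d sub unfolding r by auto
    have str: "stored M rl" "stored M rr"
      using st unfolding r by auto
    note rootsr = str[THEN stored_root]
    show ?thesis
    proof (cases "ht rr < ht rl")
      case True
      then obtain m rll km rlr where rl: "rl = Node m rll km rlr"
        by (cases rl) auto
      have m: "m < f" "m \<noteq> p" "m \<noteq> q" "m \<notin> set (addrs rr)" "m \<notin> set (addrs rll)"
          "m \<notin> set (addrs rlr)" "m \<notin> set (addrs l)"
        and pq: "p \<notin> set (addrs rll)" "p \<notin> set (addrs rlr)" "q \<notin> set (addrs rll)" "q \<notin> set (addrs rlr)"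
        using d sub unfolding r rl by auto
      have stm: "stored M rll" "stored M rlr"
        using str unfolding rl by auto
      note rootsm = stm[THEN stored_root]
      let ?L = "Node p l k rll" and ?R = "Node q rlr kr rr"
      let ?M1 = "stamp M p ?L"
      let ?M2 = "stamp ?M1 q ?R"
      let ?t = "Node m ?L km ?R"
      have b: "balance p l k r = ?t"
        using left True by (simp add: balance_defs r rl)
      have "reshaped M f (set (addrs (Node p l k r))) ?t (stamp ?M2 m ?t)"
        using p q pr m pq st str stm unfolding reshaped_def r rl
        by (simp add: stamp)
      then show ?thesis
        unfolding b
        using left True p q pr m pq st str stm roots rootsr rootsm
          wp_node[of M l rll p k] wp_node[of ?M1 rlr rr q kr] wp_node[of ?M2 ?L ?R m km]
        by (simp add: balance_code_def wp_fld stamp r rl)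
    next
      case False
      let ?L = "Node p l k rl"
      let ?M1 = "stamp M p ?L"
      let ?t = "Node q ?L kr rr"
      have b: "balance p l k r = ?t"
        using left False by (simp add: balance_defs r)
      have "reshaped M f (set (addrs (Node p l k r))) ?t (stamp ?M1 q ?t)"
        using p q pr st str unfolding reshaped_def r
        by (simp add: stamp)
      then show ?thesis
        unfolding b
        using left False p q pr st str roots rootsr
          wp_node[of M l rl p k] wp_node[of ?M1 ?L rr q kr]
        by (simp add: balance_code_def wp_fld stamp r)
    qed
  next
    case none
    have b: "balance p l k r = Node p l k r"
      using none by (simp add: balance_def)
    have "reshaped M f (set (addrs (Node p l k r))) (Node p l k r) (stamp M p (Node p l k r))"
      using p st unfolding reshaped_def by (simp add: stamp)
    then show ?thesis
      unfolding b
      using none p roots wp_node[of M l r p k]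
      by (simp add: balance_code_def wp_fld stamp)
  qed
qed


lemma wp_mono:
  "wp P \<rho> M e Q \<Longrightarrow> (\<And>v M' t. Q v M' t \<Longrightarrow> R v M' t) \<Longrightarrow> wp P \<rho> M e R"
  unfolding wp_def by blast

lemma stamp_new:
  assumes "length M = loc f"
  shows "length (stamp M f t) = loc (Suc f)"
    and "node (stamp M f t) f = words t"
    and "q \<noteq> f \<Longrightarrow> node (stamp M f t) q = node M q"
    and "j < 3 \<Longrightarrow> stamp M f t ! j = M ! j"
  using assms by (simp_all add: stamp_def length_put node_put_same node_put_other put_header)

lemma wp_update_leaf:
  assumes st: "stored M (Leaf p a n d)" and p: "p < f"
    and len: "length M = loc f" and free: "M ! 2 = Idx (loc f)"
  shows "wp market_procs (args [Idx (loc p), Idx x, Qty v]) M update_code (\<lambda>w M' s.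
     w = Idx (loc p) \<and> s \<le> 1200 \<and> stored M' (update f x v (Leaf p a n d)) \<and>
     length M' = loc (if a = x then f else f + 2) \<and>
     M' ! 2 = Idx (loc (if a = x then f else f + 2)) \<and> M' ! 0 = M ! 0 \<and>
     (\<forall>i<f. i \<noteq> p \<longrightarrow> node M' i = node M i))"
proof -
  have hdr: "j < length M" if "j < 3" for j
    using that loc_ge[of f] len by simp
  have node_p: "node M p = [Idx 0, Idx a, Qty d, Qty d, Idx n, Idx 0, Idx 0]"
    using st by simp
  have le: "loc p \<le> loc f"
    using p by (simp add: loc_def)
  note code = update_code_def wp_fld wp_store
  show ?thesis
  proof (cases "a = x")
    case True
    have "put M (loc p) [Idx 0, Idx x, Qty (d + v), Qty (d + v), Idx n, Idx 0, Idx 0]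
        = stamp M p (Leaf p x n (d + v))"
      by (simp add: stamp_def)
    then show ?thesis
      using True p le by (simp add: code node_p len stamp_simps[where f = f] free)
  next
    case False
    let ?B = "Leaf f x (a + n - x) v" and ?A = "Leaf (Suc f) a (x - a) d"
    let ?M1 = "stamp M f ?B"
    let ?M2 = "stamp ?M1 (Suc f) ?A"
    let ?M3 = "?M2[2 := Idx (loc (f + 2))]"
    let ?t = "Node p ?A x ?B"
    have B: "put M (loc f) [Idx 0, Idx x, Qty v, Qty v, Idx (a + n - x), Idx 0, Idx 0] = ?M1"
      by (simp add: stamp_def)
    have A: "put ?M1 (loc f + 7) [Idx 0, Idx a, Qty d, Qty d, Idx (x - a), Idx 0, Idx 0] = ?M2"
      by (simp add: stamp_def)
    have W: "write_word ?M2 2 (Idx (loc f + 14)) = ?M3"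
      using hdr len by (simp add: write_word_def stamp_new loc_def)
    have n: "p \<noteq> f" "p \<noteq> Suc f"
      using p by auto
    have len3: "length ?M3 = loc (f + 2)"
      using len by (simp add: stamp_new loc_def)
    have nodes: "node ?M3 f = words ?B" "node ?M3 (Suc f) = words ?A"
      and nodes': "\<And>i. i < f \<Longrightarrow> node ?M3 i = node M i" 
      using len by (simp_all add: node_header stamp_new)
    have hdr3: "?M3 ! 0 = M ! 0" "?M3 ! 2 = Idx (loc (f + 2))"
      using len by (simp_all add: stamp_new)
    note wp3 = wp_node[of ?M3 ?A ?B p x, folded stamp_def]
    show ?thesis
      using False p le hdr n nodes nodes' hdr3 len3 wp3
      by (simp add: code node_p len free A B W stamp_new stamp_simps[where f = "f + 2"])
  qed
qed

text \<open>The frame clause on blocks outside the subtree keeps the sibling and the parent block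
  valid across the recursive call. A level is charged 1200 steps: at most 1000 for
  \<open>balance_code\<close> and 100 for the rest of the body; a leaf is covered as well.\<close>

lemma wp_update:
  assumes "tiles lo hi t" "lo \<le> x" "x < hi" "stored M t" "distinct (addrs t)"
    and "set (addrs t) \<subseteq> {..<f}" "length M = loc f" "M ! 2 = Idx (loc f)"
  shows "wp market_procs (args [Idx (loc (root_block t)), Idx x, Qty v]) M update_code (\<lambda>w M' s.
     w = Idx (loc (root_block (update f x v t))) \<and> s \<le> 1200 * (ht t + 1) \<and>
     stored M' (update f x v t) \<and>
     length M' = loc (f + (length (addrs (update f x v t)) - length (addrs t))) \<and>
     M' ! 2 = Idx (length M') \<and> M' ! 0 = M ! 0 \<and>
     (\<forall>i<f. i \<notin> set (addrs t) \<longrightarrow> node M' i = node M i))"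
  using assms
proof (induction t arbitrary: lo hi)
  case (Leaf p a n d)
  then have "stored M (Leaf p a n d)" "p < f"
    by auto
  from wp_update_leaf[OF this Leaf.prems(7,8)] show ?case
    unfolding root_block.simps by (rule wp_mono) (auto simp: loc_def)
next
  case (Node p l k r)
  have t: "tiles lo k l" "tiles k hi r" and st: "stored M l" "stored M r"
    and sub: "set (addrs l) \<subseteq> {..<f}" "set (addrs r) \<subseteq> {..<f}"
    and dist: "distinct (addrs l)" "distinct (addrs r)"
    and p: "p < f" "p \<notin> set (addrs l)" "p \<notin> set (addrs r)"
    and dj: "set (addrs l) \<inter> set (addrs r) = {}"
    using Node.prems by auto
  have node_p: "node M p = words (Node p l k r)"
    using Node.prems(4) by simp
  show ?case
  proof (cases "x < k")
    case True
    let ?l = "update f x v l"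
    define g where "g = f + (length (addrs ?l) - length (addrs l))"
    obtain M1 s1 where e1: "exec market_procs (args [Idx (loc (root_block l)), Idx x, Qty v]) M update_code
          (Idx (loc (root_block ?l))) M1 s1"
      and s1: "s1 \<le> 1200 * (ht l + 1)" "stored M1 ?l" "length M1 = loc g"
        "M1 ! 2 = Idx (loc g)" "M1 ! 0 = M ! 0"
        "\<And>i. i < f \<Longrightarrow> i \<notin> set (addrs l) \<Longrightarrow> node M1 i = node M i"
      using Node.IH(1)[OF t(1) _ True st(1) dist(1) sub(1)] Node.prems
      unfolding wp_def g_def by auto
    have ad: "distinct (addrs ?l)" "set (addrs ?l) \<subseteq> set (addrs l) \<union> {f..<g}"
        "length (addrs l) \<le> length (addrs ?l)"
      using addrs_update[OF t(1) _ True dist(1) sub(1), of v] Node.prems(2) unfolding g_def by blast+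
    \<comment> \<open>Here the code reads the key and the right child after the recursive call,
      hence in \<open>M1\<close>. In the other case the recursive call is the last argument and
      \<open>node_p\<close> suffices.\<close>
    have node1: "node M1 p = words (Node p l k r)"
      using s1(6)[of p] p node_p by simp
    have old: "i \<in> set (addrs l)" if "i \<in> set (addrs ?l)" "i < f" for i
      using ad(2) that by fastforce
    have "p \<notin> set (addrs ?l)" "set (addrs ?l) \<inter> set (addrs r) = {}"
      using old p dj sub by blast+
    then have dist': "distinct (addrs (Node p ?l k r))"
      using ad(1) dist p by auto
    have "f \<le> g"
      by (simp add: g_def)
    then have sub': "set (addrs (Node p ?l k r)) \<subseteq> {..<g}"
      using ad(2) p sub by fastforce
    have "stored M1 r"
      using st(2) stored_cong[of r M1 M] s1(6) dj sub by blast
    then obtain M2 s2 where e2: "exec market_procs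
          (args [Idx (loc p), Idx (loc (root_block ?l)), Idx k, Idx (loc (root_block r))]) M1 balance_code
          (Idx (loc (root_block (balance p ?l k r)))) M2 s2"
      and s2: "s2 \<le> 1000" "reshaped M1 g (set (addrs (Node p ?l k r))) (balance p ?l k r) M2"
      using wp_balance[OF s1(2) _ dist' sub' s1(3)] unfolding wp_def by auto
    have fr: "node M2 i = node M i" if "i < f" "i \<notin> set (addrs (Node p l k r))" for i
      using s2(2) s1(6)[of i] that old unfolding reshaped_def by auto
    have run: "wp market_procs (args [Idx (loc p), Idx x, Qty v]) M update_code (\<lambda>w M' s.
        w = Idx (loc (root_block (balance p ?l k r))) \<and> M' = M2 \<and> s \<le> s1 + s2 + 100)"
      using True
      \<comment> \<open>A single unfolding leaves the recursive call folded, so that its run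
        \<open>e1\<close> applies.\<close>
      by (subst update_code_def) (simp add: wp_fld node_p node1 wp_exec[OF e1] wp_exec[OF e2])
    have time: "s1 + s2 + 100 \<le> 1200 * (ht (Node p l k r) + 1)"
      using s1(1) s2(1) by simp
    have len: "length M2 = loc (f + (length (addrs (update f x v (Node p l k r))) - length (addrs (Node p l k r))))"
      using True s2(2) ad(3) by (simp add: reshaped_def g_def)
    have hdr: "M2 ! 2 = Idx (length M2)" "M2 ! 0 = M ! 0" "stored M2 (balance p ?l k r)"
      using s1(4,5) s2(2) by (simp_all add: reshaped_def)
    show ?thesis
      unfolding root_block.simps by (rule wp_mono[OF run]) (use True time len hdr fr in auto)
  next
    case False
    then have x: "k \<le> x"
      by simp
    let ?r = "update f x v r"
    define g where "g = f + (length (addrs ?r) - length (addrs r))"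
    obtain M1 s1 where e1: "exec market_procs (args [Idx (loc (root_block r)), Idx x, Qty v]) M update_code
          (Idx (loc (root_block ?r))) M1 s1"
      and s1: "s1 \<le> 1200 * (ht r + 1)" "stored M1 ?r" "length M1 = loc g"
        "M1 ! 2 = Idx (loc g)" "M1 ! 0 = M ! 0"
        "\<And>i. i < f \<Longrightarrow> i \<notin> set (addrs r) \<Longrightarrow> node M1 i = node M i"
      using Node.IH(2)[OF t(2) x _ st(2) dist(2) sub(2)] Node.prems
      unfolding wp_def g_def by auto
    have ad: "distinct (addrs ?r)" "set (addrs ?r) \<subseteq> set (addrs r) \<union> {f..<g}"
        "length (addrs r) \<le> length (addrs ?r)"
      using addrs_update[OF t(2) x _ dist(2) sub(2), of v] Node.prems(3) unfolding g_def by blast+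
    have old: "i \<in> set (addrs r)" if "i \<in> set (addrs ?r)" "i < f" for i
      using ad(2) that by fastforce
    have "p \<notin> set (addrs ?r)" "set (addrs ?r) \<inter> set (addrs l) = {}"
      using old p dj sub by blast+
    then have dist': "distinct (addrs (Node p l k ?r))"
      using ad(1) dist p by auto
    have "f \<le> g"
      by (simp add: g_def)
    then have sub': "set (addrs (Node p l k ?r)) \<subseteq> {..<g}"
      using ad(2) p sub by fastforce
    have "stored M1 l"
      using st(1) stored_cong[of l M1 M] s1(6) dj sub by blast
    then obtain M2 s2 where e2: "exec market_procs
          (args [Idx (loc p), Idx (loc (root_block l)), Idx k, Idx (loc (root_block ?r))]) M1 balance_code
          (Idx (loc (root_block (balance p l k ?r)))) M2 s2"
      and s2: "s2 \<le> 1000" "reshaped M1 g (set (addrs (Node p l k ?r))) (balance p l k ?r) M2"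
      using wp_balance[OF _ s1(2) dist' sub' s1(3)] unfolding wp_def by auto
    have fr: "node M2 i = node M i" if "i < f" "i \<notin> set (addrs (Node p l k r))" for i
      using s2(2) s1(6)[of i] that old unfolding reshaped_def by auto
    have run: "wp market_procs (args [Idx (loc p), Idx x, Qty v]) M update_code (\<lambda>w M' s.
        w = Idx (loc (root_block (balance p l k ?r))) \<and> M' = M2 \<and> s \<le> s1 + s2 + 100)"
      using False
      by (subst update_code_def) (simp add: wp_fld node_p wp_exec[OF e1] wp_exec[OF e2])
    have time: "s1 + s2 + 100 \<le> 1200 * (ht (Node p l k r) + 1)"
      using s1(1) s2(1) by simp
    have len: "length M2 = loc (f + (length (addrs (update f x v (Node p l k r))) - length (addrs (Node p l k r))))"
      using False s2(2) ad(3) by (simp add: reshaped_def g_def)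
    have hdr: "M2 ! 2 = Idx (length M2)" "M2 ! 0 = M ! 0" "stored M2 (balance p l k ?r)"
      using s1(4,5) s2(2) by (simp_all add: reshaped_def)
    show ?thesis
      unfolding root_block.simps by (rule wp_mono[OF run]) (use False time len hdr fr in auto)
  qed
qed

section \<open>The data structure\<close>

text \<open>
  The endpoint \<open>r + 1 = N\<close> bounds no segment and is left out of the tree. Address 10 is the first
  one behind the initial leaf at address 3.
\<close>

definition market :: market_ds where
  "market = \<lparr>
     procedures = market_procs,
     init_code =
       Bind 1 (Write (Const_Idx 0) (Var 0)) (
       Bind 1 (Write (Const_Idx 1) (Const_Idx 3)) (
       Bind 1 (Write (Const_Idx 2) (Const_Idx 10)) (
       Call 0 [Const_Idx 3, Const_Idx 0, Const_Idx 0, Zero_Qty, Zero_Qty, Var 0,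
         Const_Idx 0, Const_Idx 0]))),
     purchase_code =
       Bind 3 (Write (Const_Idx 1) (Call 3 [Read (Const_Idx 1), Var 0, Var 2])) (
       Cond (Binop Less (offset (Var 1) 1) (Read (Const_Idx 0)))
         (Write (Const_Idx 1)
           (Call 3 [Read (Const_Idx 1), offset (Var 1) 1, Binop Sub Zero_Qty (Var 2)]))
         (Const_Idx 0)),
     max_code = Bind 0 (Read (Const_Idx 1)) (fld 0 3),
     count_code = Bind 0 (Read (Const_Idx 1)) (fld 0 4)\<rparr>"

text \<open>Distinct blocks below \<open>length (addrs t)\<close> are exactly the first ones, so
  there is no garbage and the tree determines the memory size.\<close>

definition represents :: "nat \<Rightarrow> mem \<Rightarrow> seg_tree \<Rightarrow> bool" where
  "represents N M t \<longleftrightarrow> stored M t \<and> distinct (addrs t) \<and>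
     set (addrs t) \<subseteq> {..<length (addrs t)} \<and> length M = loc (length (addrs t)) \<and>
     M ! 0 = Idx N \<and> M ! 1 = Idx (loc (root_block t)) \<and> M ! 2 = Idx (length M) \<and>
     tiles 0 N t \<and> avl t"

text \<open>The invariant is restored only when word 1 points to the new root; this write is left to
  the caller of \<open>update_code\<close>.\<close>

lemma exec_update_represents:
  fixes t :: seg_tree and x :: nat and v :: real
  defines "t' \<equiv> update (length (addrs t)) x v t"
  assumes rep: "represents N M t" and x: "x < N"
  shows "\<exists>M' s. exec market_procs (args [Idx (loc (root_block t)), Idx x, Qty v]) M update_code
      (Idx (loc (root_block t'))) M' s \<and> s \<le> 1200 * (ht t + 1) \<and> 3 \<le> length M' \<and>
    represents N (M'[1 := Idx (loc (root_block t'))]) t'"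
proof -
  let ?f = "length (addrs t)" and ?w = "Idx (loc (root_block t'))"
  have r: "tiles 0 N t" "stored M t" "distinct (addrs t)" "set (addrs t) \<subseteq> {..<?f}"
      "length M = loc ?f" "M ! 2 = Idx (loc ?f)" "M ! 0 = Idx N" "avl t"
    using rep unfolding represents_def by auto
  have ad: "distinct (addrs t')"
      "set (addrs t') \<subseteq> set (addrs t) \<union> {?f..<?f + (length (addrs t') - ?f)}"
      "?f \<le> length (addrs t')"
    using addrs_update[OF r(1) _ x r(3,4), of v] unfolding t'_def by blast+
  obtain M' s where e: "exec market_procs (args [Idx (loc (root_block t)), Idx x, Qty v]) M update_code ?w M' s"
    and s: "s \<le> 1200 * (ht t + 1)" "stored M' t'"
      "length M' = loc (length (addrs t'))" "M' ! 2 = Idx (length M')" "M' ! 0 = Idx N"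
    using wp_update[OF r(1) _ x r(2-6), of v] r(7) ad(3) unfolding t'_def wp_def by auto
  have "3 \<le> length M'"
    using s(3) loc_ge by simp
  moreover have "stored (M'[1 := ?w]) t'"
    using s(2) stored_cong[of "t'" "M'[1 := ?w]" M'] by (simp add: node_header)
  moreover have "tiles 0 N t'" "avl t'"
    using tiles_update[OF r(1) _ x] avl_update[OF r(8)] unfolding t'_def by auto
  moreover have "set (addrs t') \<subseteq> {..<length (addrs t')}"
    using ad(2,3) r(4) by fastforce
  ultimately show ?thesis
    using e s ad(1) unfolding represents_def by (intro exI[of _ M'] exI[of _ s]) auto
qed

text \<open>A suffix is raised by \<open>v\<close> at \<open>l\<close> and lowered again at
  \<open>r + 1\<close>. The first update may increase the height \<open>h\<close> by one, so the two
  take at most \<open>1200 * (h + 1) + 1200 * (h + 2)\<close> steps, which leaves 400 for the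
  rest.\<close>

lemma serve_purchase:
  assumes rep: "represents N M t" and lr: "l \<le> r" "r < N"
  shows "\<exists>a M' s t'. serve market (Purchase l r v) M a M' s \<and> s \<le> 2400 * ht t + 4000 \<and>
    represents N M' t' \<and> starts t' \<subseteq> starts t \<union> {l, r + 1} \<and>
    (\<forall>i<N. level t' i = update_shares (Purchase l r v) (level t) i)"
proof -
  have hdr: "M ! 0 = Idx N" "M ! 1 = Idx (loc (root_block t))" "3 \<le> length M"
      and tiles: "tiles 0 N t" and "avl t"
    using rep loc_ge unfolding represents_def by auto
  have l: "l < N"
    using lr by simp
  let ?t1 = "update (length (addrs t)) l v t"
  obtain M1 s1 where e1: "exec market_procs (args [Idx (loc (root_block t)), Idx l, Qty v]) M update_code
        (Idx (loc (root_block ?t1))) M1 s1"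
      and s1: "s1 \<le> 1200 * (ht t + 1)" and len1: "3 \<le> length M1"
      and rep1: "represents N (M1[1 := Idx (loc (root_block ?t1))]) ?t1"
    using exec_update_represents[OF rep l, of v] by blast
  let ?M1 = "M1[1 := Idx (loc (root_block ?t1))]"
  have hdr1: "?M1 ! 0 = Idx N" "?M1 ! 1 = Idx (loc (root_block ?t1))" and tiles1: "tiles 0 N ?t1"
    using rep1 unfolding represents_def by auto
  have ht1: "ht ?t1 \<le> Suc (ht t)"
    using avl_update[OF \<open>avl t\<close>] by blast
  have starts1: "starts ?t1 = insert l (starts t)"
    using starts_update[OF tiles _ l] by simp
  have level1: "level ?t1 i = level t i + (if l \<le> i then v else 0)" if "i < N" for i
    using level_update[OF tiles _ l _ that] by simp
  have "M1 \<noteq> []"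
    using len1 by auto
  have W1: "write_word M1 1 w = M1[1 := w]" for w
    using len1 by (simp add: write_word_def)
  show ?thesis
  proof (cases "r + 1 < N")
    case True
    let ?t2 = "update (length (addrs ?t1)) (r + 1) (- v) ?t1"
    obtain M2 s2 where e2: "exec market_procs (args [Idx (loc (root_block ?t1)), Idx (r + 1), Qty (- v)])
          ?M1 update_code (Idx (loc (root_block ?t2))) M2 s2"
        and s2: "s2 \<le> 1200 * (ht ?t1 + 1)" and len2: "3 \<le> length M2"
        and rep2: "represents N (M2[1 := Idx (loc (root_block ?t2))]) ?t2"
      using exec_update_represents[OF rep1 True, of "- v"] by blast
    have W2: "write_word M2 1 w = M2[1 := w]" for w
      using len2 by (simp add: write_word_def)
    have starts2: "starts ?t2 = insert (r + 1) (starts ?t1)"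
      using starts_update[OF tiles1 _ True] by simp
    have level2: "level ?t2 i = level ?t1 i + (if r + 1 \<le> i then - v else 0)" if "i < N" for i
      using level_update[OF tiles1 _ True _ that] by simp
    have "wp market_procs (args [Idx l, Idx r, Qty v]) M (purchase_code market)
        (\<lambda>a M' s. s \<le> 2400 * ht t + 4000 \<and> M' = M2[1 := Idx (loc (root_block ?t2))])"
      using hdr hdr1 s1 s2 ht1 len1 len2 True \<open>M1 \<noteq> []\<close> e2
      by (simp add: market_def W1 W2 wp_exec[OF e1] wp_exec[OF e2])
    then obtain a s where "serve market (Purchase l r v) M a (M2[1 := Idx (loc (root_block ?t2))]) s"
        "s \<le> 2400 * ht t + 4000"
      unfolding wp_def by (auto simp: market_def)
    then show ?thesis
      using rep2 starts1 starts2 level1 level2 lr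
      by (intro exI[of _ a] exI[of _ "M2[1 := Idx (loc (root_block ?t2))]"] exI[of _ s] exI[of _ ?t2]) auto
  next
    case False
    have "wp market_procs (args [Idx l, Idx r, Qty v]) M (purchase_code market)
        (\<lambda>a M' s. s \<le> 2400 * ht t + 4000 \<and> M' = ?M1)"
      using hdr hdr1 s1 len1 False \<open>M1 \<noteq> []\<close>
      by (simp add: market_def W1 wp_exec[OF e1])
    then obtain a s where "serve market (Purchase l r v) M a ?M1 s" "s \<le> 2400 * ht t + 4000"
      unfolding wp_def by (auto simp: market_def)
    then show ?thesis
      using rep1 starts1 level1 False lr
      by (intro exI[of _ a] exI[of _ ?M1] exI[of _ s] exI[of _ ?t1]) auto
  qed
qed

lemma serve_query:
  assumes "represents N M t"
  shows "serve market Query_Max M (Qty (peak t)) M 7"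
    and "serve market Query_Count M (Idx (peak_count t)) M 7"
proof -
  have hdr: "M ! 1 = Idx (loc (root_block t))" "3 \<le> length M" and "stored M t"
    using assms loc_ge unfolding represents_def by auto
  note root = stored_root[OF \<open>stored M t\<close>]
  have "wp market_procs (args []) M (max_code market) (\<lambda>v M' s. v = Qty (peak t) \<and> M' = M \<and> s = 7)"
    "wp market_procs (args []) M (count_code market)
      (\<lambda>v M' s. v = Idx (peak_count t) \<and> M' = M \<and> s = 7)"
    using hdr by (simp_all add: market_def wp_fld root)
  then show "serve market Query_Max M (Qty (peak t)) M 7"
    "serve market Query_Count M (Idx (peak_count t)) M 7"
    unfolding wp_def by (auto simp: market_def)
qed

lemma initialize_market:
  assumes "0 < N"
  shows "\<exists>M t. initialize market N M t \<and> t \<le> 100 \<and> represents N M (Leaf 0 0 N 0)"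
proof -
  let ?M = "[Idx N, Idx 3, Idx 10, Idx 0, Idx 0, Qty 0, Qty 0, Idx N, Idx 0, Idx 0]"
  have "wp market_procs (args [Idx N]) [] (init_code market) (\<lambda>a M t. M = ?M \<and> t \<le> 100)"
    by (simp add: market_def wp_store write_word_def put_def)
  moreover have "represents N ?M (Leaf 0 0 N 0)"
    using assms by (simp add: represents_def node_def loc_def)
  ultimately show ?thesis
    unfolding wp_def initialize_def by (auto simp: market_def)
qed

text \<open>\<open>insert 0\<close> accounts for the initial segment, whose start need not be an
  endpoint of a purchase; the endpoint \<open>N\<close> never becomes a start, hence an inclusion
  only.\<close>

definition reflects :: "nat \<Rightarrow> request list \<Rightarrow> mem \<Rightarrow> seg_tree \<Rightarrow> bool" where
  "reflects N rs M t \<longleftrightarrow> represents N M t \<and> (\<forall>i<N. level t i = shares rs i) \<and>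
     starts t \<subseteq> insert 0 (\<Union>r\<in>set rs. request_endpoints r)"

lemma shares_snoc: "shares (rs @ [r]) = update_shares r (shares rs)"
  by (simp add: shares_def)

lemma serve_deterministic:
  "serve D r M a M1 s \<Longrightarrow> serve D r M b M2 t \<Longrightarrow> M2 = M1"
  by (cases r) (auto dest: exec_deterministic(1))

text \<open>The runs exhibited so far are, by determinism, the ones that occur in
  \<open>reaches\<close>; so the invariant carries over to every reachable memory.\<close>

lemma reaches_reflects:
  assumes "reaches market N rs M" "0 < N" "\<forall>r\<in>set rs. valid_request N r"
  shows "\<exists>t. reflects N rs M t"
  using assms
proof (induction rule: reaches.induct)
  case (reaches_init M t)
  obtain M' t' where M': "initialize market N M' t'" "represents N M' (Leaf 0 0 N 0)"
    using initialize_market[OF \<open>0 < N\<close>] by blast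
  then have "M = M'"
    using reaches_init(1) unfolding initialize_def by (auto dest: exec_deterministic(1))
  then have "reflects N [] M (Leaf 0 0 N 0)"
    using M'(2) by (simp add: reflects_def shares_def)
  then show ?case ..
next
  case (reaches_serve rs M r a M' s)
  then obtain t where rep: "represents N M t" and level: "\<forall>i<N. level t i = shares rs i"
      and starts: "starts t \<subseteq> insert 0 (\<Union>r\<in>set rs. request_endpoints r)"
    unfolding reflects_def by auto
  show ?case
  proof (cases r)
    case (Purchase l u v)
    then have "l \<le> u" "u < N"
      using reaches_serve.prems by auto
    from serve_purchase[OF rep this, of v] Purchase
    obtain b M1 s1 t1 where "serve market r M b M1 s1" "represents N M1 t1"
        "starts t1 \<subseteq> starts t \<union> {l, u + 1}"
        "\<forall>i<N. level t1 i = update_shares (Purchase l u v) (level t) i"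
      by blast
    moreover from this have "M' = M1"
      using reaches_serve.hyps(2) serve_deterministic by blast
    ultimately have "reflects N (rs @ [r]) M' t1"
      using Purchase level starts unfolding reflects_def shares_snoc by auto
    then show ?thesis ..
  next
    case Query_Max
    with serve_query(1)[OF rep] have "M' = M"
      using reaches_serve.hyps(2) serve_deterministic by blast
    then have "reflects N (rs @ [r]) M' t"
      using Query_Max rep level starts unfolding reflects_def shares_snoc by auto
    then show ?thesis ..
  next
    case Query_Count
    with serve_query(2)[OF rep] have "M' = M"
      using reaches_serve.hyps(2) serve_deterministic by blast
    then have "reflects N (rs @ [r]) M' t"
      using Query_Count rep level starts unfolding reflects_def shares_snoc by auto
    then show ?thesis ..
  qed
qed

lemma q_max_eq:
  assumes "tiles 0 N t" "\<forall>i<N. level t i = q i"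
  shows "q_max N q = peak t" "s_qmax N q = peak_count t"
proof -
  note pk = peak_level[OF assms(1)]
  have "\<forall>i<N. q i \<le> peak t"
    using pk assms(2) by auto
  moreover obtain i where "i < N" "peak t = q i"
    using pk assms(2) by auto
  ultimately show max: "q_max N q = peak t"
    unfolding q_max_def by (intro Max_eqI) auto
  have "{i \<in> {..<N}. q i = peak t} = {i \<in> {0..<N}. level t i = peak t}"
    using assms(2) by auto
  then show "s_qmax N q = peak_count t"
    unfolding s_qmax_def max using pk by simp
qed

section \<open>Bounds in terms of the number of endpoints\<close>

lemma card_starts_le:
  assumes "reflects N rs M t"
  shows "card (starts t) \<le> num_endpoints rs + 1"
proof -
  let ?E = "\<Union>r\<in>set rs. request_endpoints r"
  have "finite (request_endpoints r)" for r
    by (cases r) auto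
  then have "finite ?E"
    by simp
  then have "card (starts t) \<le> card (insert 0 ?E)"
    using assms unfolding reflects_def by (intro card_mono) auto
  also have "\<dots> \<le> num_endpoints rs + 1"
    unfolding num_endpoints_def using card_insert_le_m1[of 1] \<open>finite ?E\<close>
    by (simp add: card_insert_if)
  finally show ?thesis .
qed

text \<open>With two endpoints the logarithm is at least 1 and absorbs additive constants.
  Monotonicity relates the tree before the purchase to the count after it.\<close>

lemma num_endpoints_purchase:
  assumes "l \<le> r"
  shows "2 \<le> num_endpoints (rs @ [Purchase l r v])"
    and "num_endpoints rs \<le> num_endpoints (rs @ [Purchase l r v])"
proof -
  let ?E = "\<Union>r\<in>set rs. request_endpoints r"
  have "finite (request_endpoints r)" for r
    by (cases r) auto
  then have fin: "finite ?E"
    by simp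
  have eq: "num_endpoints (rs @ [Purchase l r v]) = card (?E \<union> {l, r + 1})"
    by (simp add: num_endpoints_def Un_commute)
  have "card {l, r + 1} = 2"
    using assms by auto
  moreover have "card {l, r + 1} \<le> card (?E \<union> {l, r + 1})"
    using fin by (intro card_mono) auto
  ultimately show "2 \<le> num_endpoints (rs @ [Purchase l r v])"
    unfolding eq by simp
  show "num_endpoints rs \<le> num_endpoints (rs @ [Purchase l r v])"
    unfolding eq num_endpoints_def using fin by (intro card_mono) auto
qed

text \<open>For \<open>k\<close> at least 2, \<open>k + 1\<close> is at most \<open>k ^ 2\<close>,
  so \<open>2 ^ h\<close> is at most \<open>k ^ 4\<close>; this turns a logarithm of
  \<open>k + 1\<close> into one of \<open>k\<close>.\<close>

lemma ht_le_log:
  assumes "2 ^ h \<le> c\<^sup>2" "c \<le> k + 1" "2 \<le> (k::nat)"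
  shows "real h \<le> 4 * log 2 (real k)"
proof -
  have "2 * k \<le> k * k"
    using assms(3) by (rule mult_le_mono1)
  then have "c \<le> k\<^sup>2"
    using assms(2,3) unfolding power2_eq_square by linarith
  then have "c\<^sup>2 \<le> (k\<^sup>2)\<^sup>2"
    by (rule power_mono) simp
  with assms(1) have "2 ^ h \<le> k ^ 4"
    by (simp flip: power_mult)
  then have "(2::real) ^ h \<le> real k ^ 4"
    by (metis of_nat_le_iff of_nat_numeral of_nat_power)
  then have "log 2 (2 ^ h) \<le> log 2 (real k ^ 4)"
    using assms(3) by (subst log_le_cancel_iff) auto
  then show ?thesis
    using assms(3) by (simp add: log_nat_power)
qed

theorem mainTheorem9:
  "\<exists>(D :: market_ds) (C :: real). \<forall>N :: nat. N > 0 \<longrightarrow>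
     (\<exists>M t. initialize D N M t \<and> real t \<le> C) \<and>
     (\<forall>rs M. (\<forall>r \<in> set rs. valid_request N r) \<and> reaches D N rs M \<longrightarrow>
        real (length M) \<le> C * real (max 1 (num_endpoints rs)) \<and>
        (\<forall>l r v. valid_request N (Purchase l r v) \<longrightarrow>
           (\<exists>a M' t. serve D (Purchase l r v) M a M' t \<and>
              real t \<le> C * log 2 (real (num_endpoints (rs @ [Purchase l r v]))))) \<and>
        (\<exists>M' t. serve D Query_Max M (Qty (q_max N (shares rs))) M' t \<and> real t \<le> C) \<and>
        (\<exists>M' t. serve D Query_Count M (Idx (s_qmax N (shares rs))) M' t \<and> real t \<le> C))"
proof (intro exI[of _ market] exI[of _ 13600] allI impI conjI)
  \<comment> \<open>The constant is \<open>2400 * 4 + 4000\<close>: a purchase takes at most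
    \<open>2400 * h + 4000\<close> steps with \<open>h\<close> at most \<open>4 * log 2 k\<close>,
    and \<open>log 2 k\<close> is at least 1.\<close>
  fix N :: nat
  assume N: "N > 0"
  show "\<exists>M t. initialize market N M t \<and> real t \<le> 13600"
    using initialize_market[OF N] by fastforce
  fix rs M
  assume "(\<forall>r \<in> set rs. valid_request N r) \<and> reaches market N rs M"
  then obtain t where t: "reflects N rs M t"
    using reaches_reflects N by blast
  then have rep: "represents N M t" and level: "\<forall>i<N. level t i = shares rs i"
    unfolding reflects_def by auto
  then have tiles: "tiles 0 N t" and avl: "avl t" and len: "length M = loc (length (addrs t))"
    unfolding represents_def by auto
  note card = card_starts_le[OF t]
  \<comment> \<open>At most \<open>k + 1\<close> leaves make \<open>2 * k + 1\<close> blocks of 7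
    words, plus 3 header words.\<close>
  have "length M \<le> 14 * num_endpoints rs + 10"
    using length_addrs[OF tiles] card len unfolding loc_def by linarith
  then have "length M \<le> 24 * max 1 (num_endpoints rs)"
    by (simp add: max_def)
  then have "real (length M) \<le> 24 * real (max 1 (num_endpoints rs))"
    by (metis of_nat_le_iff of_nat_mult of_nat_numeral)
  then show "real (length M) \<le> 13600 * real (max 1 (num_endpoints rs))"
    by linarith
  note query = serve_query[OF rep, folded q_max_eq[OF tiles level]]
  show "\<exists>M' t. serve market Query_Max M (Qty (q_max N (shares rs))) M' t \<and> real t \<le> 13600"
    "\<exists>M' t. serve market Query_Count M (Idx (s_qmax N (shares rs))) M' t \<and> real t \<le> 13600"
    using query by fastforce+
  fix l r v
  assume "valid_request N (Purchase l r v)"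
  then have lr: "l \<le> r" "r < N"
    by auto
  let ?k = "num_endpoints (rs @ [Purchase l r v])"
  note k = num_endpoints_purchase[OF lr(1), where rs = rs and v = v]
  have h: "real (ht t) \<le> 4 * log 2 (real ?k)"
    using avl_ht[OF tiles avl] card k by (intro ht_le_log[of _ "card (starts t)"]) auto
  have "1 \<le> log 2 (real ?k)"
    using k(1) by simp
  moreover obtain a M' s where "serve market (Purchase l r v) M a M' s" "s \<le> 2400 * ht t + 4000"
    using serve_purchase[OF rep lr] by blast
  moreover from this(2) have "real s \<le> real (2400 * ht t + 4000)"
    by (simp only: of_nat_le_iff)
  ultimately show "\<exists>a M' t. serve market (Purchase l r v) M a M' t \<and> real t \<le> 13600 * log 2 (real ?k)"
    using h by (intro exI[of _ a] exI[of _ M'] exI[of _ s]) auto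
qed

end
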